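(* Consider the optimal control problem (P) described in the context. A feasible point $(\sigma,u,p,h,z,a)$ is optimal if and only if there exist $\lambda\in V^{k-1}$, $\mu\in V^k$, $\nu\in\mathfrak H^k$ and $\xi\in\mathbb R^{b_k}$ such that $$w_\sigma\langle R\sigma-r_d,R\tau\rangle_{Y_\sigma}-\langle\lambda,\tau\rangle-\langle\mu,d\tau\rangle=0\quad\forall\tau\in V^{k-1},$$ $$w_y\langle O(u+h)-y_d,Ov\rangle_Y+\langle v,d\lambda\rangle-\langle d\mu,dv\rangle-\langle v,\nu\rangle=0\quad\forall v\in V^k,$$ $$\langle\mu,q\rangle=0\quad\forall q\in\mathfrak H^k,$$ $$w_y\langle O(u+h)-y_d,O\eta\rangle_Y+w_\Pi(\boldsymbol\Pi h-\pi_d)\cdot\boldsymbol\Pi\eta+\xi\cdot\boldsymbol\Pi\eta=0\quad\forall\eta\in\mathfrak H^k,$$ and the variational inequalities $$\langle\alpha z+B^*\mu,\widetilde z-z\rangle_Z\ge0\quad\forall\widetilde z\in Z_{\rm ad},$$ $$(\alpha_{\rm top}a-G^T\xi)\cdot(\widetilde a-a)\ge0\quad\forall\widetilde a\in A_{\rm ad}$$ hold.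
   Context: A Hilbert complex $(W,d)$ consists of real Hilbert spaces $W^k$ and densely defined closed linear operators $d^k:V^k\subset W^k\to W^{k+1}$ with $d^k V^k\subset V^{k+1}$, $d^{k+1}d^k=0$; $V^k$ carries the graph norm. It is closed if every $\operatorname{range}d^{k-1}$ is closed in $W^k$; here $(W,d)$ is closed. The harmonic space is $\mathfrak H^k=\ker d^k\cap(\operatorname{range}d^{k-1})^{\perp}$, of finite dimension $b_k$. Superscripts on $d$ are suppressed and $\langle\cdot,\cdot\rangle$ denotes the relevant $W$ inner product. Data: Hilbert spaces $Z,Y,Y_\sigma$; bounded linear $B:Z\to W^k$ (with Hilbert adjoint $B^*:W^k\to Z$), $O:W^k\to Y$, $R:W^{k-1}\to Y_\sigma$; a linear isomorphism $\boldsymbol\Pi:\mathfrak H^k\to\mathbb R^{b_k}$; nonempty closed convex $Z_{\rm ad}\subset Z$, $A_{\rm ad}\subset\mathbb R^m$; $f\in W^k$, $y_d\in Y$, $r_d\in Y_\sigma$, $\pi_d,c_0\in\mathbb R^{b_k}$, $G\in\mathbb R^{b_k\times m}$; weights $w_y,w_\sigma,w_\Pi\ge0$, $\alpha>0$, $\alpha_{\rm top}>0$. Problem (P): minimize $$J(\sigma,u,h,z,a)=\tfrac{w_y}{2}\|O(u+h)-y_d\|_Y^2+\tfrac{w_\sigma}{2}\|R\sigma-r_d\|_{Y_\sigma}^2+\tfrac{w_\Pi}{2}\|\boldsymbol\Pi h-\pi_d\|_{\mathbb R^{b_k}}^2+\tfrac{\alpha}{2}\|z\|_Z^2+\tfrac{\alpha_{\rm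 top}}{2}|a|^2$$ over $\sigma\in V^{k-1}$, $u\in V^k$, $p,h\in\mathfrak H^k$, $z\in Z_{\rm ad}$, $a\in A_{\rm ad}$ subject to $$\langle\sigma,\tau\rangle-\langle u,d\tau\rangle=0\quad\forall\tau\in V^{k-1},$$ $$\langle d\sigma,v\rangle+\langle du,dv\rangle+\langle p,v\rangle=\langle f+Bz,v\rangle\quad\forall v\in V^k,$$ $$\langle u,q\rangle=0\quad\forall q\in\mathfrak H^k,\qquad \boldsymbol\Pi h=Ga+c_0 .$$ A point is feasible if it satisfies all these constraints (including $z\in Z_{\rm ad}$, $a\in A_{\rm ad}$), and optimal if it minimizes $J$ among feasible points. *)

theory Defs
  imports "HOL-Analysis.Analysis"
begin

definition linear_on :: "'a::real_vector set \<Rightarrow> ('a \<Rightarrow> 'b::real_vector) \<Rightarrow> bool" where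
  "linear_on S T \<longleftrightarrow>
     (\<forall>x\<in>S. \<forall>y\<in>S. T (x + y) = T x + T y) \<and> (\<forall>c. \<forall>x\<in>S. T (c *\<^sub>R x) = c *\<^sub>R T x)"

definition bounded_linear_on ::
    "'a::real_normed_vector set \<Rightarrow> ('a \<Rightarrow> 'b::real_normed_vector) \<Rightarrow> bool" where
  "bounded_linear_on S T \<longleftrightarrow> linear_on S T \<and> (\<exists>K. \<forall>x\<in>S. norm (T x) \<le> K * norm x)"

text \<open>
  A type cannot depend on the degree \<open>k\<close>, so the Hilbert spaces \<open>W k\<close> are closed subspaces of one
  Hilbert space, the type \<open>'w\<close>; any sequence of Hilbert spaces arises in this way inside its Hilbert
  direct sum. Degrees are integers, so that \<open>k - 1\<close> is always available; a complex that starts in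
  degree 0 is extended by zero spaces. The domain of the unbounded operator \<open>d k\<close> is \<open>V k\<close>, and
  the values of \<open>d k\<close> outside \<open>V k\<close> are irrelevant.
\<close>

locale hilbert_complex =
  fixes W V :: "int \<Rightarrow> 'w::{real_inner, complete_space} set"
    and d :: "int \<Rightarrow> 'w \<Rightarrow> 'w"
  assumes subspace_W: "subspace (W k)"
    and closed_W: "closed (W k)"
    and subspace_V: "subspace (V k)"
    and V_subset_W: "V k \<subseteq> W k"
    and V_dense: "W k \<subseteq> closure (V k)"
    and linear_d: "linear_on (V k) (d k)"
    and closed_graph_d: "closed {(x, d k x) | x. x \<in> V k}"
    and d_in_V: "d k ` V k \<subseteq> V (k + 1)"
    and d_d: "x \<in> V k \<Longrightarrow> d (k + 1) (d k x) = 0"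

locale closed_hilbert_complex = hilbert_complex +
  assumes closed_range_d: "closed (d k ` V k)"

definition harmonic ::
    "(int \<Rightarrow> 'w::real_inner set) \<Rightarrow> (int \<Rightarrow> 'w \<Rightarrow> 'w) \<Rightarrow> int \<Rightarrow> 'w set" where
  "harmonic V d k = {x \<in> V k. d k x = 0} \<inter> (d (k - 1) ` V (k - 1))\<^sup>\<bottom>"

text \<open>
  The dimensions \<open>b\<close> and \<open>m\<close> are natural numbers that may be 0, so the coordinate space of dimension
  \<open>n\<close> is \<^term>\<open>Euclidean_space n\<close>: functions \<open>nat \<Rightarrow> real\<close> that vanish from index \<open>n\<close> on.
  Of a matrix with \<open>n\<close> rows and \<open>m\<close> columns only the entries \<open>G i j\<close> with \<open>i < n\<close>, \<open>j < m\<close> matter.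
\<close>

definition dot :: "nat \<Rightarrow> (nat \<Rightarrow> real) \<Rightarrow> (nat \<Rightarrow> real) \<Rightarrow> real" where
  "dot n x y = (\<Sum>i<n. x i * y i)"

definition mat_vec ::
    "nat \<Rightarrow> nat \<Rightarrow> (nat \<Rightarrow> nat \<Rightarrow> real) \<Rightarrow> (nat \<Rightarrow> real) \<Rightarrow> nat \<Rightarrow> real" where
  "mat_vec n m G x = (\<lambda>i. if i < n then (\<Sum>j<m. G i j * x j) else 0)"

definition mat_transpose :: "(nat \<Rightarrow> nat \<Rightarrow> real) \<Rightarrow> nat \<Rightarrow> nat \<Rightarrow> real" where
  "mat_transpose G = (\<lambda>i j. G j i)"

text \<open>The library's \<^const>\<open>convex\<close> needs a vector space type, which \<open>nat \<Rightarrow> real\<close> is not.\<close>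

definition convex_fun :: "(nat \<Rightarrow> real) set \<Rightarrow> bool" where
  "convex_fun A \<longleftrightarrow>
     (\<forall>x\<in>A. \<forall>y\<in>A. \<forall>s\<ge>0. \<forall>t\<ge>0. s + t = 1 \<longrightarrow> (\<lambda>i. s * x i + t * y i) \<in> A)"

definition linear_iso_Euclidean :: "nat \<Rightarrow> 'a::real_vector set \<Rightarrow> ('a \<Rightarrow> nat \<Rightarrow> real) \<Rightarrow> bool" where
  "linear_iso_Euclidean n S T \<longleftrightarrow>
     (\<forall>i. linear_on S (\<lambda>x. T x i)) \<and> bij_betw T S (topspace (Euclidean_space n))"

definition cost ::
    "('w::real_inner \<Rightarrow> 'y::real_inner) \<Rightarrow> ('w \<Rightarrow> 's::real_inner) \<Rightarrow> nat \<Rightarrow> ('w \<Rightarrow> nat \<Rightarrow> real) \<Rightarrow> nat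
      \<Rightarrow> 'y \<Rightarrow> 's \<Rightarrow> (nat \<Rightarrow> real) \<Rightarrow> real \<Rightarrow> real \<Rightarrow> real \<Rightarrow> real \<Rightarrow> real
      \<Rightarrow> 'w \<Rightarrow> 'w \<Rightarrow> 'w \<Rightarrow> 'z::real_inner \<Rightarrow> (nat \<Rightarrow> real) \<Rightarrow> real" where
  "cost Obs R b Per m y_d r_d pi_d w_y w_sigma w_Pi \<alpha> \<alpha>_top \<sigma> u h z a =
     w_y / 2 * (norm (Obs (u + h) - y_d))\<^sup>2
     + w_sigma / 2 * (norm (R \<sigma> - r_d))\<^sup>2
     + w_Pi / 2 * (L2_set (\<lambda>i. Per h i - pi_d i) {..<b})\<^sup>2
     + \<alpha> / 2 * (norm z)\<^sup>2
     + \<alpha>_top / 2 * (L2_set a {..<m})\<^sup>2"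

definition feasible ::
    "(int \<Rightarrow> 'w::real_inner set) \<Rightarrow> (int \<Rightarrow> 'w \<Rightarrow> 'w) \<Rightarrow> int \<Rightarrow> ('z \<Rightarrow> 'w)
      \<Rightarrow> nat \<Rightarrow> ('w \<Rightarrow> nat \<Rightarrow> real) \<Rightarrow> nat \<Rightarrow> (nat \<Rightarrow> nat \<Rightarrow> real) \<Rightarrow> (nat \<Rightarrow> real) \<Rightarrow> 'w
      \<Rightarrow> 'z set \<Rightarrow> (nat \<Rightarrow> real) set
      \<Rightarrow> 'w \<times> 'w \<times> 'w \<times> 'w \<times> 'z \<times> (nat \<Rightarrow> real) \<Rightarrow> bool" where
  "feasible V d k B b Per m G c\<^sub>0 f Z_ad A_ad = (\<lambda>(\<sigma>, u, p, h, z, a).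
     \<sigma> \<in> V (k - 1) \<and> u \<in> V k \<and> p \<in> harmonic V d k \<and> h \<in> harmonic V d k \<and>
     z \<in> Z_ad \<and> a \<in> A_ad \<and>
     (\<forall>\<tau>\<in>V (k - 1). \<sigma> \<bullet> \<tau> - u \<bullet> d (k - 1) \<tau> = 0) \<and>
     (\<forall>v\<in>V k. d (k - 1) \<sigma> \<bullet> v + d k u \<bullet> d k v + p \<bullet> v = (f + B z) \<bullet> v) \<and>
     (\<forall>q\<in>harmonic V d k. u \<bullet> q = 0) \<and>
     Per h = (\<lambda>i. mat_vec b m G a i + c\<^sub>0 i))"

end

theory Submission
  imports Defs
begin

text \<open>
  The cost is a convex quadratic function and the constraints are affine apart from the convex sets
  of controls, so a feasible point is optimal iff the directional derivative of the cost towards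
  every feasible point is nonnegative. The mixed Hodge Laplace problem is self-adjoint and, since
  the complex is closed, solvable for every right-hand side. Solving it once with the control
  variations as data shows that every control variation is realized by a feasible direction;
  solving it once with the Riesz representatives of the derivatives in \<open>\<sigma>\<close> and \<open>u\<close> as data gives
  \<open>\<lambda>\<close>, \<open>\<mu>\<close>, \<open>\<nu>\<close> (with \<open>\<lambda>\<close> the negative of the \<open>\<sigma>\<close>-component). Testing each of the two systems with
  the solution of the other turns the directional derivative into an expression in the control
  variations only, and this splits into the two variational inequalities.
\<close>

section \<open>Linear operators on subspaces of Hilbert spaces\<close>

lemma linear_on_add: "linear_on S T \<Longrightarrow> x \<in> S \<Longrightarrow> y \<in> S \<Longrightarrow> T (x + y) = T x + T y"
  by (simp add: linear_on_def)

lemma linear_on_scaleR: "linear_on S T \<Longrightarrow> x \<in> S \<Longrightarrow> T (c *\<^sub>R x) = c *\<^sub>R T x"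
  by (simp add: linear_on_def)

lemma linear_on_0: "linear_on S T \<Longrightarrow> subspace S \<Longrightarrow> T 0 = 0"
  using linear_on_scaleR[of S T 0 0] by (simp add: subspace_0)

lemma linear_on_diff:
  assumes "linear_on S T" "subspace S" "x \<in> S" "y \<in> S"
  shows "T (x - y) = T x - T y"
  using linear_on_add[of S T "x - y" y] assms by (simp add: subspace_diff)

lemma subspace_linear_on_image:
  assumes "linear_on S T" "subspace S"
  shows "subspace (T ` S)"
proof (rule subspaceI)
  show "0 \<in> T ` S"
    using linear_on_0[OF assms] subspace_0[OF assms(2)] by force
next
  fix x y assume "x \<in> T ` S" "y \<in> T ` S"
  then obtain x' y' where "x' \<in> S" "y' \<in> S" "x = T x'" "y = T y'" by blast
  then show "x + y \<in> T ` S"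
    using linear_on_add[OF assms(1), of x' y'] subspace_add[OF assms(2), of x' y'] by (metis imageI)
next
  fix c x assume "x \<in> T ` S"
  then obtain x' where "x' \<in> S" "x = T x'" by blast
  then show "c *\<^sub>R x \<in> T ` S"
    using linear_on_scaleR[OF assms(1), of x' c] subspace_scale[OF assms(2), of x' c] by (metis imageI)
qed

lemma subspace_linear_on_kernel:
  assumes "linear_on S T" "subspace S"
  shows "subspace {x \<in> S. T x = 0}"
proof (rule subspaceI)
  show "0 \<in> {x \<in> S. T x = 0}"
    using linear_on_0[OF assms] subspace_0[OF assms(2)] by simp
qed (use assms in \<open>auto simp: linear_on_add linear_on_scaleR subspace_add subspace_scale\<close>)

text \<open>The kernel is the slice of the graph at second coordinate 0, so closedness of the graph
  stands in for continuity of \<open>T\<close>.\<close>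

lemma closed_kernel_closed_graph:
  fixes T :: "'a::t2_space \<Rightarrow> 'b::{t2_space, zero}"
  assumes "closed {(x, T x) | x. x \<in> D}"
  shows "closed {x \<in> D. T x = 0}"
proof -
  have "{x \<in> D. T x = 0} = (\<lambda>x. (x, 0)) -` {(x, T x) | x. x \<in> D}"
    by auto
  then show ?thesis
    using continuous_closed_vimage[OF assms, of "\<lambda>x. (x, 0)"] continuous_Pair[OF continuous_ident continuous_const]
    by metis
qed

text \<open>Divide by \<open>t\<close> and let \<open>t\<close> tend to 0 from the right. This is
  how a minimum yields a first-order condition, both in the Riesz representation and for the control
  problem.\<close>

lemma nonneg_slope:
  fixes L Q :: real
  assumes "\<And>t. 0 < t \<Longrightarrow> t \<le> 1 \<Longrightarrow> 0 \<le> t * L + t\<^sup>2 * Q"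
  shows "0 \<le> L"
proof -
  have "((\<lambda>t. L + t * Q) \<longlongrightarrow> L + 0 * Q) (at_right 0)"
    by (intro tendsto_intros)
  moreover have "eventually (\<lambda>t. 0 \<le> L + t * Q) (at_right (0::real))"
  proof (rule eventually_at_rightI[of 0 1])
    fix t :: real assume t: "t \<in> {0<..<1}"
    then have "0 \<le> t * (L + t * Q)"
      using assms[of t] by (simp add: algebra_simps power2_eq_square)
    then show "0 \<le> L + t * Q" using t by (simp add: zero_le_mult_iff)
  qed simp
  ultimately show ?thesis
    using tendsto_lowerbound[of "\<lambda>t. L + t * Q" "L + 0 * Q" "at_right 0" 0] by simp
qed

text \<open>The representative minimizes \<open>x \<mapsto> norm x ^ 2 / 2 - \<phi> x\<close> over \<open>S\<close>; minimizing sequences are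
  Cauchy by the parallelogram law.\<close>

lemma riesz_representation:
  fixes S :: "'a::{real_inner, complete_space} set" and \<phi> :: "'a \<Rightarrow> real"
  assumes S: "subspace S" "closed S" and \<phi>: "bounded_linear_on S \<phi>"
  obtains y where "y \<in> S" "\<And>x. x \<in> S \<Longrightarrow> \<phi> x = y \<bullet> x"
proof -
  obtain K where lin: "linear_on S \<phi>" and K: "\<And>x. x \<in> S \<Longrightarrow> \<bar>\<phi> x\<bar> \<le> K * norm x"
    using \<phi> unfolding bounded_linear_on_def by auto
  define J where "J x = (norm x)\<^sup>2 / 2 - \<phi> x" for x
  have J_lower: "- (K\<^sup>2 / 2) \<le> J x" if "x \<in> S" for x
  proof -
    \<comment> \<open>Expanding the square gives \<open>K * norm x\<close> at most half of
      \<open>(norm x)\<^sup>2 + K\<^sup>2\<close>, which absorbs the linear term of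
      \<open>J\<close>.\<close>
    have "0 \<le> (norm x - K)\<^sup>2" by simp
    then show ?thesis
      using K[OF that] unfolding J_def by (simp add: power2_diff algebra_simps)
  qed
  have bdd: "bdd_below (J ` S)"
    using J_lower by (auto intro!: bdd_belowI2[of _ "- (K\<^sup>2 / 2)"])
  have ne: "J ` S \<noteq> {}" using subspace_0[OF S(1)] by blast
  define m where "m = Inf (J ` S)"
  have m: "m \<le> J x" if "x \<in> S" for x
    unfolding m_def using bdd that by (intro cInf_lower) auto
  have "\<exists>x\<in>S. J x < m + inverse (real (Suc n))" for n
    using cInf_lessD[OF ne, of "m + inverse (real (Suc n))"] unfolding m_def by auto
  then obtain X where X: "\<And>n. X n \<in> S" "\<And>n. J (X n) < m + inverse (real (Suc n))"
    by metis
  \<comment> \<open>With \<open>?c\<close> the midpoint, the parallelogram law reads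
    \<open>(norm (x - y))\<^sup>2 = 4 * J x + 4 * J y - 8 * J ?c\<close>, and \<open>J ?c\<close> is
    at least \<open>m\<close> because the midpoint lies in \<open>S\<close>.\<close>
  have par: "(norm (x - y))\<^sup>2 \<le> 4 * (J x - m) + 4 * (J y - m)" if "x \<in> S" "y \<in> S" for x y
  proof -
    let ?c = "(1/2) *\<^sub>R (x + y)"
    have "?c \<in> S" by (intro subspace_scale subspace_add S that)
    moreover have "\<phi> ?c = (\<phi> x + \<phi> y) / 2"
      using linear_on_scaleR[OF lin subspace_add[OF S(1) that], of "1/2"] linear_on_add[OF lin that]
      by simp
    ultimately have "m \<le> (norm ?c)\<^sup>2 / 2 - (\<phi> x + \<phi> y) / 2"
      using m[of ?c] unfolding J_def by presburger
    moreover have "(norm ?c)\<^sup>2 = ((norm x)\<^sup>2 + (norm y)\<^sup>2) / 2 - (norm (x - y))\<^sup>2 / 4"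
      unfolding power2_norm_eq_inner by (simp add: inner_commute[of y x] inner_diff inner_add field_simps)
    ultimately show ?thesis unfolding J_def by argo
  qed
  have "Cauchy X"
  proof (rule metric_CauchyI)
    fix e :: real assume e: "e > 0"
    obtain N where N: "inverse (real (Suc N)) < e\<^sup>2 / 8"
      using reals_Archimedean[of "e\<^sup>2 / 8"] e by auto
    have "dist (X i) (X j) < e" if "i \<ge> N" "j \<ge> N" for i j
    proof -
      have "J (X l) - m < e\<^sup>2 / 8" if "l \<ge> N" for l
      proof -
        have "inverse (real (Suc l)) \<le> inverse (real (Suc N))" using that by (simp add: le_imp_inverse_le)
        then show ?thesis using X(2)[of l] N by linarith
      qed
      from this[OF that(1)] this[OF that(2)] par[OF X(1) X(1), of i j]
      have "(norm (X i - X j))\<^sup>2 < e\<^sup>2" by argo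
      then show ?thesis using e by (simp add: dist_norm power2_less_imp_less)
    qed
    then show "\<exists>M. \<forall>m\<ge>M. \<forall>n\<ge>M. dist (X m) (X n) < e" by blast
  qed
  then obtain y where y: "X \<longlonglongrightarrow> y"
    using Cauchy_convergent_iff convergent_def by blast
  have yS: "y \<in> S" using closed_sequentially[OF S(2) _ y] X(1) by blast
  have "(\<lambda>n. \<phi> (X n) - \<phi> y) \<longlonglongrightarrow> 0"
  proof (rule Lim_null_comparison)
    show "eventually (\<lambda>n. norm (\<phi> (X n) - \<phi> y) \<le> K * norm (X n - y)) sequentially"
    proof (intro always_eventually allI)
      fix n
      show "norm (\<phi> (X n) - \<phi> y) \<le> K * norm (X n - y)"
        using K[OF subspace_diff[OF S(1) X(1)[of n] yS]] linear_on_diff[OF lin S(1) X(1)[of n] yS]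
        by simp
    qed
    show "(\<lambda>n. K * norm (X n - y)) \<longlonglongrightarrow> 0"
      using tendsto_mult_right_zero[OF tendsto_norm_zero[OF LIM_zero[OF y]], of K] by simp
  qed
  then have lim: "(\<lambda>n. \<phi> (X n)) \<longlonglongrightarrow> \<phi> y"
    by (rule LIM_zero_cancel)
  have "(\<lambda>n. J (X n)) \<longlonglongrightarrow> J y"
    unfolding J_def by (intro tendsto_diff lim tendsto_divide tendsto_power tendsto_norm y tendsto_const) simp
  then have "J y \<le> m"
    by (rule LIMSEQ_le[OF _ LIMSEQ_inverse_real_of_nat_add]) (use X(2) less_imp_le in blast)
  then have Jy: "J y \<le> J x" if "x \<in> S" for x using m[OF that] by linarith
  \<comment> \<open>First variation of \<open>J\<close> at its minimizer \<open>y\<close> in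
    direction \<open>x\<close>. Applied to \<open>x\<close> and to \<open>- x\<close> it forces
    equality.\<close>
  have ge: "0 \<le> y \<bullet> x - \<phi> x" if "x \<in> S" for x
  proof (rule nonneg_slope[of _ "(norm x)\<^sup>2 / 2"])
    fix t :: real
    have "\<phi> (y + t *\<^sub>R x) = \<phi> y + t * \<phi> x"
      using linear_on_add[OF lin yS subspace_scale[OF S(1) that]] linear_on_scaleR[OF lin that] by simp
    moreover have "(norm (y + t *\<^sub>R x))\<^sup>2 = (norm y)\<^sup>2 + 2 * (t * (y \<bullet> x)) + t\<^sup>2 * (norm x)\<^sup>2"
      unfolding power2_norm_eq_inner by (simp add: algebra_simps inner_commute[of x y] power2_eq_square)
    ultimately show "0 \<le> t * (y \<bullet> x - \<phi> x) + t\<^sup>2 * ((norm x)\<^sup>2 / 2)"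
      using Jy[OF subspace_add[OF S(1) yS subspace_scale[OF S(1) that]], of t]
      unfolding J_def by (simp add: algebra_simps)
  qed
  have "\<phi> x = y \<bullet> x" if "x \<in> S" for x
    using ge[OF that] ge[OF subspace_neg[OF S(1) that]] linear_on_scaleR[OF lin that, of "-1"] by simp
  with yS that show thesis by blast
qed

text \<open>Riesz representation on \<open>S\<close> of the functional given by \<open>g\<close>.
  The vector \<open>y\<close> is the orthogonal projection of \<open>g\<close>, since
  \<open>g - y\<close> is orthogonal to \<open>S\<close>.\<close>

lemma orthogonal_projection:
  fixes S :: "'a::{real_inner, complete_space} set"
  assumes "subspace S" "closed S"
  obtains y where "y \<in> S" "\<And>x. x \<in> S \<Longrightarrow> g \<bullet> x = y \<bullet> x"
proof (rule riesz_representation[OF assms, of "\<lambda>x. g \<bullet> x"])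
  show "bounded_linear_on S (\<lambda>x. g \<bullet> x)"
    unfolding bounded_linear_on_def linear_on_def
    by (auto simp: inner_add_right intro: exI[of _ "norm g"] Cauchy_Schwarz_ineq2)
qed (use that in blast)

text \<open>\<open>adjoint\<close> is defined by choice, so an operator with the adjoint property
  has to be exhibited first. Its values are the Riesz representatives of the functionals
  \<open>\<lambda>x. B x \<bullet> y\<close>.\<close>

lemma adjoint_complete:
  fixes B :: "'a::{real_inner, complete_space} \<Rightarrow> 'b::real_inner"
  assumes "bounded_linear B"
  shows "B x \<bullet> y = x \<bullet> adjoint B y"
proof -
  have "\<exists>w. \<forall>x. B x \<bullet> y = w \<bullet> x" for y
  proof -
    interpret bounded_linear "\<lambda>x. B x \<bullet> y"
      using bounded_linear_inner_left_comp[OF assms] .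
    have "bounded_linear_on UNIV (\<lambda>x. B x \<bullet> y)"
      unfolding bounded_linear_on_def linear_on_def
      using bounded by (auto simp: add scaleR mult.commute)
    then show ?thesis
      using riesz_representation[of UNIV "\<lambda>x. B x \<bullet> y"] by fastforce
  qed
  then obtain B' where "\<And>x y. B x \<bullet> y = B' y \<bullet> x" by metis
  then have "\<forall>x y. B x \<bullet> y = x \<bullet> B' y" by (simp add: inner_commute)
  then show ?thesis using adjoint_unique by metis
qed

section \<open>Bounded preimages and duality for operators with closed range\<close>

lemma geometric_increments:
  fixes s :: "nat \<Rightarrow> 'a::real_normed_vector"
  assumes "\<And>n. norm (s (Suc n) - s n) \<le> c / 2 ^ n"
  shows "norm (s (n + j) - s n) \<le> 2 * c / 2 ^ n - 2 * c / 2 ^ (n + j)"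
proof (induction j)
  case (Suc j)
  have "norm (s (n + Suc j) - s n) \<le> norm (s (n + j) - s n) + norm (s (Suc (n + j)) - s (n + j))"
    using norm_triangle_ineq[of "s (n + j) - s n" "s (Suc (n + j)) - s (n + j)"] by simp
  also have "\<dots> \<le> 2 * c / 2 ^ n - 2 * c / 2 ^ (n + j) + c / 2 ^ (n + j)"
    using Suc assms[of "n + j"] by linarith
  finally show ?case by (simp add: field_simps)
qed simp

lemma Cauchy_geometric_increments:
  fixes s :: "nat \<Rightarrow> 'a::real_normed_vector"
  assumes s: "\<And>n. norm (s (Suc n) - s n) \<le> c / 2 ^ n"
  shows "Cauchy s"
proof (rule metric_CauchyI)
  have c: "0 \<le> c" using order_trans[OF norm_ge_zero s[of 0]] by simp
  have bd: "norm (s (n + j) - s n) \<le> 2 * c / 2 ^ n" for n j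
    using geometric_increments[of s c, OF s, where n = n and j = j] c by (smt (verit) divide_nonneg_pos zero_less_power)
  fix e :: real assume e: "e > 0"
  have "(\<lambda>n. 2 * c * (1 / 2) ^ n) \<longlonglongrightarrow> 0"
    by (intro tendsto_mult_right_zero LIMSEQ_power_zero) simp
  then have "eventually (\<lambda>n. 2 * c * (1 / 2) ^ n < e / 2) sequentially"
    using e by (intro order_tendstoD(2)) auto
  then obtain N where "2 * c * (1 / 2) ^ N < e / 2"
    by (auto simp: eventually_sequentially)
  then have N: "2 * c / 2 ^ N < e / 2" by (simp add: power_divide)
  have "dist (s i) (s N) < e / 2" if "i \<ge> N" for i
    using bd[of N "i - N"] N that by (simp add: dist_norm)
  then show "\<exists>M. \<forall>m\<ge>M. \<forall>n\<ge>M. dist (s m) (s n) < e"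
    using dist_triangle_half_l by blast
qed

text \<open>The Baire half of the open mapping theorem. The closed range is complete and is covered
  by the closures of the images of balls, so one of these closures has interior relative to the
  range. Closures only yield preimages up to an error \<open>\<delta>\<close>.\<close>

lemma closed_range_preimage_approx:
  fixes T :: "'a::real_normed_vector \<Rightarrow> 'b::{real_normed_vector, complete_space}"
  assumes D: "subspace D" and lin: "linear_on D T" and closed: "closed (T ` D)"
  obtains C where "C \<ge> 0"
    "\<And>y \<delta>. y \<in> T ` D \<Longrightarrow> \<delta> > 0 \<Longrightarrow> \<exists>x\<in>D. norm x \<le> C * norm y \<and> norm (y - T x) < \<delta>"
proof -
  let ?R = "T ` D"
  let ?X = "top_of_set ?R"
  define E where "E n = closure (T ` (D \<inter> cball 0 (real n)))" for n
  have R: "subspace ?R" by (rule subspace_linear_on_image[OF lin D])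
  have ER: "E n \<subseteq> ?R" for n
    unfolding E_def by (intro closure_minimal closed) auto
  have UE: "\<Union>(range E) = ?R"
  proof
    show "?R \<subseteq> \<Union>(range E)"
    proof
      fix y assume "y \<in> ?R"
      then obtain x where x: "x \<in> D" "y = T x" by blast
      obtain n where "norm x \<le> real n" using real_arch_simple by blast
      with x have "y \<in> T ` (D \<inter> cball 0 (real n))" by simp
      then have "y \<in> E n" unfolding E_def by (rule subsetD[OF closure_subset])
      then show "y \<in> \<Union>(range E)" by blast
    qed
  qed (use ER in blast)
  have "\<exists>n. ?X interior_of E n \<noteq> {}"
  proof (rule ccontr)
    assume "\<nexists>n. ?X interior_of E n \<noteq> {}"
    moreover have "completely_metrizable_space ?X"
      using closed closed_closedin completely_metrizable_space_closedin
        completely_metrizable_space_euclidean by blast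
    moreover have "closedin ?X (E n)" for n
      using ER[of n] by (intro closed_subset) (auto simp: E_def)
    ultimately have "?X interior_of \<Union>(range E) = {}"
      by (intro Baire_category_alt) auto
    then show False
      unfolding UE using subspace_0[OF R] interior_of_topspace[of ?X] by auto
  qed
  then obtain n y0 U where "openin ?X U" "y0 \<in> U" "U \<subseteq> E n"
    unfolding interior_of_def by blast
  then obtain e where e: "e > 0" "\<And>y. y \<in> ?R \<Longrightarrow> dist y y0 < e \<Longrightarrow> y \<in> E n"
    and y0: "y0 \<in> E n" "y0 \<in> ?R"
    unfolding openin_euclidean_subtopology_iff by blast
  \<comment> \<open>Write \<open>y\<close> as the difference of \<open>y0 + y\<close> and
    \<open>y0\<close>. Both lie in \<open>E n\<close>, so each is within \<open>\<delta> / 2\<close>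
    of the image of a vector of norm at most \<open>n\<close>; subtracting these vectors doubles the
    radius.\<close>
  have small: "\<exists>x\<in>D. norm x \<le> 2 * real n \<and> norm (y - T x) < \<delta>"
    if y: "y \<in> ?R" "norm y < e" and \<delta>: "\<delta> > 0" for y \<delta>
  proof -
    have "y0 + y \<in> E n"
      using y e(2)[of "y0 + y"] subspace_add[OF R y0(2) y(1)] by (simp add: dist_norm)
    then obtain x1 where x1: "x1 \<in> D" "norm x1 \<le> real n" "dist (T x1) (y0 + y) < \<delta> / 2"
      unfolding E_def closure_approachable using \<delta> half_gt_zero[OF \<delta>] by fastforce
    obtain x2 where x2: "x2 \<in> D" "norm x2 \<le> real n" "dist (T x2) y0 < \<delta> / 2"
      using y0(1) unfolding E_def closure_approachable using half_gt_zero[OF \<delta>] by fastforce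
    have "norm (y - T (x1 - x2)) = norm ((y0 + y - T x1) - (y0 - T x2))"
      unfolding linear_on_diff[OF lin D x1(1) x2(1)] by (simp add: algebra_simps)
    also have "\<dots> \<le> norm (y0 + y - T x1) + norm (y0 - T x2)"
      by (rule norm_triangle_ineq4)
    also have "\<dots> < \<delta>" using x1(3) x2(3) by (simp add: dist_norm norm_minus_commute)
    finally have "norm (y - T (x1 - x2)) < \<delta>" .
    moreover have "norm (x1 - x2) \<le> 2 * real n"
      using norm_triangle_ineq4[of x1 x2] x1(2) x2(2) by linarith
    ultimately show ?thesis using subspace_diff[OF D x1(1) x2(1)] by blast
  qed
  \<comment> \<open>Dividing by \<open>r\<close> rescales \<open>y\<close> to norm
    \<open>e / 2\<close>. Scaling its approximate preimage of norm at most \<open>2 * n\<close> back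
    by \<open>r = 2 * norm y / e\<close> produces the constant.\<close>
  show thesis
  proof (rule that[of "4 * real n / e"])
    fix y and \<delta> :: real assume y: "y \<in> ?R" and \<delta>: "\<delta> > 0"
    show "\<exists>x\<in>D. norm x \<le> 4 * real n / e * norm y \<and> norm (y - T x) < \<delta>"
    proof (cases "y = 0")
      case True
      then show ?thesis
        using \<delta> subspace_0[OF D] linear_on_0[OF lin D] by (intro bexI[of _ 0]) auto
    next
      case False
      define r where "r = 2 * norm y / e"
      have r: "r > 0" unfolding r_def using False e by simp
      have "norm ((1 / r) *\<^sub>R y) < e"
        using r e False unfolding r_def by (simp add: field_simps)
      then obtain x where x: "x \<in> D" "norm x \<le> 2 * real n" "norm ((1 / r) *\<^sub>R y - T x) < \<delta> / r"
        using small[OF subspace_scale[OF R y, of "1 / r"], of "\<delta> / r"] r \<delta> by auto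
      have "y - T (r *\<^sub>R x) = r *\<^sub>R ((1 / r) *\<^sub>R y - T x)"
        using linear_on_scaleR[OF lin x(1), of r] r by (simp add: algebra_simps)
      then have "norm (y - T (r *\<^sub>R x)) = r * norm ((1 / r) *\<^sub>R y - T x)"
        using r by simp
      then have "norm (y - T (r *\<^sub>R x)) < \<delta>" using x(3) r by (simp add: field_simps)
      moreover have "norm (r *\<^sub>R x) \<le> 4 * real n / e * norm y"
        using mult_left_mono[OF x(2), of r] r e unfolding r_def by (simp add: mult_ac)
      ultimately show ?thesis using subspace_scale[OF D x(1)] by blast
    qed
  qed (use e in simp)
qed

text \<open>The iteration half of the open mapping theorem. Approximate preimages of the successive
  residuals are added up, halving the residual each time. The increments are dominated by a
  geometric series with sum \<open>2 * C * norm y\<close>, and the closed graph identifies the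
  limit.\<close>

lemma closed_range_bounded_preimage:
  fixes T :: "'a::{real_normed_vector, complete_space} \<Rightarrow> 'b::{real_normed_vector, complete_space}"
  assumes D: "subspace D" and lin: "linear_on D T"
    and graph: "closed {(x, T x) | x. x \<in> D}" and closed: "closed (T ` D)"
  obtains C where "\<And>y. y \<in> T ` D \<Longrightarrow> \<exists>x\<in>D. T x = y \<and> norm x \<le> C * norm y"
proof -
  have R: "subspace (T ` D)" by (rule subspace_linear_on_image[OF lin D])
  obtain C where C: "C \<ge> 0"
    "\<And>y \<delta>. y \<in> T ` D \<Longrightarrow> \<delta> > 0 \<Longrightarrow> \<exists>x\<in>D. norm x \<le> C * norm y \<and> norm (y - T x) < \<delta>"
    using closed_range_preimage_approx[OF D lin closed] by metis
  have "\<exists>x\<in>D. T x = y \<and> norm x \<le> 2 * C * norm y" if y: "y \<in> T ` D" for y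
  proof (cases "y = 0")
    case True
    then show ?thesis using subspace_0[OF D] linear_on_0[OF lin D] by (intro bexI[of _ 0]) auto
  next
    case False
    \<comment> \<open>The clause for \<open>n = 0\<close> starts the iteration at 0, so that the
      bound on \<open>s (0 + j) - s 0\<close> bounds \<open>s j\<close> itself.\<close>
    let ?P = "\<lambda>n x. x \<in> D \<and> norm (y - T x) \<le> norm y / 2 ^ n \<and> (n = 0 \<longrightarrow> x = 0)"
    have "\<exists>s. \<forall>n. ?P n (s n) \<and> norm (s (Suc n) - s n) \<le> C * norm y / 2 ^ n"
    proof (rule dependent_nat_choice)
      show "\<exists>x. ?P 0 x" using subspace_0[OF D] linear_on_0[OF lin D] by (intro exI[of _ 0]) auto
    next
      fix x n assume x: "?P n x"
      have "y - T x \<in> T ` D" using x y by (intro subspace_diff[OF R]) auto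
      then obtain x' where x': "x' \<in> D" "norm x' \<le> C * norm (y - T x)"
          "norm (y - T x - T x') < norm y / 2 ^ Suc n"
        using C(2)[of "y - T x" "norm y / 2 ^ Suc n"] False by auto
      have "C * norm (y - T x) \<le> C * norm y / 2 ^ n"
        using x C(1) mult_left_mono[of "norm (y - T x)" "norm y / 2 ^ n" C] by simp
      then have "norm (x + x' - x) \<le> C * norm y / 2 ^ n" using x'(2) by simp
      moreover have "norm (y - T (x + x')) \<le> norm y / 2 ^ Suc n"
        using x'(3) linear_on_add[OF lin, of x x'] x x'(1) by (simp add: diff_diff_eq)
      ultimately show "\<exists>x'. ?P (Suc n) x' \<and> norm (x' - x) \<le> C * norm y / 2 ^ n"
        using x x'(1) subspace_add[OF D] by (intro exI[of _ "x + x'"]) blast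
    qed
    then obtain s where s: "\<And>n. s n \<in> D" "\<And>n. norm (y - T (s n)) \<le> norm y / 2 ^ n" "s 0 = 0"
      "\<And>n. norm (s (Suc n) - s n) \<le> C * norm y / 2 ^ n" by blast
    obtain x where x: "s \<longlonglongrightarrow> x"
      using Cauchy_geometric_increments[OF s(4)] Cauchy_convergent_iff convergent_def by blast
    have "(\<lambda>n. y - T (s n)) \<longlonglongrightarrow> 0"
    proof (rule Lim_null_comparison)
      have "(\<lambda>n. norm y * (1 / 2) ^ n) \<longlonglongrightarrow> 0"
        by (intro tendsto_mult_right_zero LIMSEQ_power_zero) simp
      then show "(\<lambda>n. norm y / 2 ^ n) \<longlonglongrightarrow> 0" by (simp add: power_divide)
    qed (use s in auto)
    then have "(\<lambda>n. y - (y - T (s n))) \<longlonglongrightarrow> y - 0" by (rule tendsto_diff[OF tendsto_const])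
    then have "(\<lambda>n. T (s n)) \<longlonglongrightarrow> y" by simp
    \<comment> \<open>Closedness of the graph now gives both membership of \<open>x\<close> in
      \<open>D\<close> and \<open>T x = y\<close>.\<close>
    then have lim: "(\<lambda>n. (s n, T (s n))) \<longlonglongrightarrow> (x, y)" by (rule tendsto_Pair[OF x])
    have "(s n, T (s n)) \<in> {(x, T x) | x. x \<in> D}" for n using s(1) by blast
    then have "(x, y) \<in> {(x, T x) | x. x \<in> D}" by (rule closed_sequentially[OF graph _ lim])
    moreover have "norm x \<le> 2 * C * norm y"
    proof (rule tendsto_upperbound[OF tendsto_norm[OF x]])
      have "norm (s j) \<le> 2 * C * norm y" for j
      proof -
        have "0 \<le> 2 * (C * norm y) / 2 ^ j" using C(1) by simp
        then show ?thesis using geometric_increments[of s, OF s(4), where n = 0 and j = j] s(3) by simp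
      qed
      then show "eventually (\<lambda>n. norm (s n) \<le> 2 * C * norm y) sequentially" by simp
    qed simp
    ultimately show ?thesis by auto
  qed
  with that show thesis by blast
qed

text \<open>The closed range theorem: a vector orthogonal to the kernel is in the range of the
  adjoint. The functional sending \<open>T x\<close> to \<open>w \<bullet> x\<close> is well defined
  because \<open>w\<close> annihilates the kernel and bounded because preimages can be chosen with
  controlled norm, so Riesz representation on the closed range applies.\<close>

lemma closed_range_dual_solvable:
  fixes T :: "'a::{real_inner, complete_space} \<Rightarrow> 'b::{real_inner, complete_space}"
  assumes D: "subspace D" and lin: "linear_on D T"
    and graph: "closed {(x, T x) | x. x \<in> D}" and closed: "closed (T ` D)"
    and w: "\<And>x. x \<in> D \<Longrightarrow> T x = 0 \<Longrightarrow> w \<bullet> x = 0"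
  obtains y where "y \<in> T ` D" "\<And>x. x \<in> D \<Longrightarrow> y \<bullet> T x = w \<bullet> x"
proof -
  obtain C where C: "\<And>y. y \<in> T ` D \<Longrightarrow> \<exists>x\<in>D. T x = y \<and> norm x \<le> C * norm y"
    using closed_range_bounded_preimage[OF D lin graph closed] by metis
  \<comment> \<open>\<open>SOME\<close> picks an arbitrary preimage. The next fact shows that the
    value does not depend on it, so the norm estimate may use another preimage, the one supplied by
    \<open>C\<close>.\<close>
  define \<phi> where "\<phi> y = w \<bullet> (SOME x. x \<in> D \<and> T x = y)" for y
  have \<phi>: "\<phi> (T x) = w \<bullet> x" if "x \<in> D" for x
  proof -
    define x' where "x' = (SOME x'. x' \<in> D \<and> T x' = T x)"
    have x': "x' \<in> D \<and> T x' = T x" unfolding x'_def using that by (intro someI) blast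
    then have "w \<bullet> (x' - x) = 0"
      using that by (intro w subspace_diff[OF D]) (auto simp: linear_on_diff[OF lin D])
    then show ?thesis unfolding \<phi>_def x'_def[symmetric] by (simp add: inner_diff_right)
  qed
  have "bounded_linear_on (T ` D) \<phi>"
    unfolding bounded_linear_on_def
  proof (intro conjI exI ballI)
    show "linear_on (T ` D) \<phi>"
      unfolding linear_on_def
    proof (intro conjI ballI allI)
      fix y1 y2 assume "y1 \<in> T ` D" "y2 \<in> T ` D"
      then obtain x1 x2 where "x1 \<in> D" "x2 \<in> D" "y1 = T x1" "y2 = T x2" by blast
      then show "\<phi> (y1 + y2) = \<phi> y1 + \<phi> y2"
        using \<phi>[OF subspace_add[OF D, of x1 x2]] by (simp add: \<phi> linear_on_add[OF lin] inner_add_right)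
    next
      fix c y assume "y \<in> T ` D"
      then obtain x where "x \<in> D" "y = T x" by blast
      then show "\<phi> (c *\<^sub>R y) = c *\<^sub>R \<phi> y"
        using \<phi>[OF subspace_scale[OF D, of x c]] by (simp add: \<phi> linear_on_scaleR[OF lin])
    qed
    fix y assume "y \<in> T ` D"
    then obtain x where x: "x \<in> D" "T x = y" "norm x \<le> C * norm y" using C by blast
    have "\<bar>w \<bullet> x\<bar> \<le> norm w * norm x" by (rule Cauchy_Schwarz_ineq2)
    also have "\<dots> \<le> norm w * (C * norm y)" using x(3) by (intro mult_left_mono) auto
    finally show "norm (\<phi> y) \<le> (norm w * C) * norm y" using \<phi>[OF x(1)] x(2) by (simp add: mult.assoc)
  qed
  then obtain y where "y \<in> T ` D" "\<And>x. x \<in> T ` D \<Longrightarrow> \<phi> x = y \<bullet> x"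
    using riesz_representation[OF subspace_linear_on_image[OF lin D] closed] by metis
  then show thesis using that \<phi> by (metis imageI)
qed

section \<open>The mixed Hodge Laplace problem\<close>

context closed_hilbert_complex
begin

lemma subspace_range_d: "subspace (d k ` V k)"
  by (rule subspace_linear_on_image[OF linear_d subspace_V])

lemma subspace_ker_d: "subspace {x \<in> V k. d k x = 0}"
  by (rule subspace_linear_on_kernel[OF linear_d subspace_V])

lemma closed_ker_d: "closed {x \<in> V k. d k x = 0}"
  by (rule closed_kernel_closed_graph[OF closed_graph_d])

lemma range_d_in_ker:
  assumes "x \<in> V (k - 1)"
  shows "d (k - 1) x \<in> V k" "d k (d (k - 1) x) = 0"
  using d_d[OF assms] d_in_V[of "k - 1"] assms by auto

lemma harmonicD:
  assumes "q \<in> harmonic V d k"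
  shows "q \<in> V k" "d k q = 0" "\<tau> \<in> V (k - 1) \<Longrightarrow> d (k - 1) \<tau> \<bullet> q = 0"
  using assms by (auto simp: harmonic_def orthogonal_comp_def orthogonal_def)

lemma subspace_harmonic: "subspace (harmonic V d k)"
  unfolding harmonic_def by (intro subspace_inter subspace_ker_d subspace_orthogonal_comp)

text \<open>By the Hodge decomposition \<open>g = d \<eta> + p + w\<close> with \<open>p\<close> harmonic and \<open>w \<bottom> ker d\<close>; the solution
  \<open>u\<close> has a component in the range of \<open>d (k - 1)\<close>, fixed by the first equation, and a component in
  the complement of the kernel of \<open>d k\<close>, fixed by \<open>w\<close>.\<close>

lemma mixed_hodge_laplace_solvable:
  obtains \<sigma> u p where "\<sigma> \<in> V (k - 1)" "u \<in> V k" "p \<in> harmonic V d k"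
    "\<forall>\<tau>\<in>V (k - 1). \<sigma> \<bullet> \<tau> - u \<bullet> d (k - 1) \<tau> = F \<bullet> \<tau>"
    "\<forall>v\<in>V k. d (k - 1) \<sigma> \<bullet> v + d k u \<bullet> d k v + p \<bullet> v = g \<bullet> v"
    "\<forall>q\<in>harmonic V d k. u \<bullet> q = 0"
proof -
  let ?N = "{x \<in> V k. d k x = 0}" and ?K = "{x \<in> V (k - 1). d (k - 1) x = 0}"
  \<comment> \<open>Two nested projections: \<open>n\<close> is the part of \<open>g\<close> in the
    kernel of \<open>d k\<close>, and \<open>g1\<close> is the part of \<open>n\<close> in the range
    of \<open>d (k - 1)\<close>. The remainder \<open>n - g1\<close> is the harmonic
    component.\<close>
  obtain n where n: "n \<in> ?N" "\<And>x. x \<in> ?N \<Longrightarrow> g \<bullet> x = n \<bullet> x"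
    using orthogonal_projection[OF subspace_ker_d closed_ker_d] by metis
  obtain g1 where g1: "g1 \<in> d (k - 1) ` V (k - 1)"
      "\<And>x. x \<in> d (k - 1) ` V (k - 1) \<Longrightarrow> n \<bullet> x = g1 \<bullet> x"
    using orthogonal_projection[OF subspace_range_d closed_range_d] by metis
  then obtain \<eta> where \<eta>: "\<eta> \<in> V (k - 1)" "g1 = d (k - 1) \<eta>" by blast
  have g1N: "g1 \<in> ?N" using range_d_in_ker[OF \<eta>(1)] \<eta>(2) by simp
  have p: "n - g1 \<in> harmonic V d k"
  proof -
    have "y \<bullet> (n - g1) = 0" if "y \<in> d (k - 1) ` V (k - 1)" for y
      using g1(2)[OF that] by (simp add: inner_diff_right inner_commute)
    then show ?thesis
      using subspace_diff[OF subspace_ker_d n(1) g1N]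
      by (simp add: harmonic_def orthogonal_comp_def orthogonal_def)
  qed
  \<comment> \<open>The choice of \<open>\<eta>\<close> is free up to the kernel of
    \<open>d (k - 1)\<close>. Subtracting \<open>\<kappa>\<close> keeps
    \<open>d (k - 1) \<sigma> = g1\<close> and makes \<open>\<sigma> - F\<close> orthogonal to that
    kernel, which is the solvability condition for \<open>u1\<close>.\<close>
  obtain \<kappa> where \<kappa>: "\<kappa> \<in> ?K" "\<And>x. x \<in> ?K \<Longrightarrow> (\<eta> - F) \<bullet> x = \<kappa> \<bullet> x"
    by (rule orthogonal_projection[OF subspace_ker_d[of "k - 1"] closed_ker_d, where g = "\<eta> - F"]) blast
  define \<sigma> where "\<sigma> = \<eta> - \<kappa>"
  have \<sigma>: "\<sigma> \<in> V (k - 1)" "d (k - 1) \<sigma> = g1"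
    using \<kappa>(1) \<eta> linear_on_diff[OF linear_d subspace_V] subspace_diff[OF subspace_V]
    unfolding \<sigma>_def by auto
  have \<sigma>F: "(\<sigma> - F) \<bullet> x = 0" if "x \<in> V (k - 1)" "d (k - 1) x = 0" for x
    using \<kappa>(2)[of x] that unfolding \<sigma>_def by (simp add: inner_diff_left)
  obtain u1 where u1: "u1 \<in> d (k - 1) ` V (k - 1)"
      "\<And>x. x \<in> V (k - 1) \<Longrightarrow> u1 \<bullet> d (k - 1) x = (\<sigma> - F) \<bullet> x"
    by (rule closed_range_dual_solvable[where D = "V (k - 1)" and T = "d (k - 1)" and w = "\<sigma> - F",
          OF subspace_V linear_d closed_graph_d closed_range_d])
      (use \<sigma>F in auto)
  have u1N: "u1 \<in> V k" "d k u1 = 0" using u1(1) range_d_in_ker by auto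
  have gn: "(g - n) \<bullet> x = 0" if "x \<in> V k" "d k x = 0" for x
    using n(2)[of x] that by (simp add: inner_diff_left)
  \<comment> \<open>Since \<open>g - n\<close> is orthogonal to the kernel of \<open>d k\<close>,
    duality provides the value \<open>y\<close> that \<open>d k u\<close> must take.\<close>
  obtain y where y: "y \<in> d k ` V k" "\<And>x. x \<in> V k \<Longrightarrow> y \<bullet> d k x = (g - n) \<bullet> x"
    by (rule closed_range_dual_solvable[where D = "V k" and T = "d k" and w = "g - n",
          OF subspace_V linear_d closed_graph_d closed_range_d])
      (use gn in auto)
  then obtain u' where u': "u' \<in> V k" "y = d k u'" by blast
  \<comment> \<open>Removing the kernel part of \<open>u'\<close> leaves \<open>d k u'\<close>
    unchanged. The resulting \<open>u2\<close> is orthogonal to the range of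
    \<open>d (k - 1)\<close> and to the harmonic space, so it disturbs neither the first nor the
    third equation.\<close>
  obtain \<omega> where \<omega>: "\<omega> \<in> ?N" "\<And>x. x \<in> ?N \<Longrightarrow> u' \<bullet> x = \<omega> \<bullet> x"
    by (rule orthogonal_projection[OF subspace_ker_d[of k] closed_ker_d, where g = u']) blast
  define u2 where "u2 = u' - \<omega>"
  have u2: "u2 \<in> V k" "d k u2 = y"
    using u' \<omega>(1) linear_on_diff[OF linear_d subspace_V] subspace_diff[OF subspace_V]
    unfolding u2_def by auto
  have u2N: "u2 \<bullet> x = 0" if "x \<in> V k" "d k x = 0" for x
    using \<omega>(2)[of x] that unfolding u2_def by (simp add: inner_diff_left)
  show thesis
  proof (rule that)
    show "\<sigma> \<in> V (k - 1)" by fact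
    show "u1 + u2 \<in> V k" by (intro subspace_add subspace_V u1N u2)
    show "n - g1 \<in> harmonic V d k" by fact
    show "\<forall>\<tau>\<in>V (k - 1). \<sigma> \<bullet> \<tau> - (u1 + u2) \<bullet> d (k - 1) \<tau> = F \<bullet> \<tau>"
      using u1(2) u2N range_d_in_ker by (simp add: inner_add_left inner_diff_left)
    show "\<forall>v\<in>V k. d (k - 1) \<sigma> \<bullet> v + d k (u1 + u2) \<bullet> d k v + (n - g1) \<bullet> v = g \<bullet> v"
      using \<sigma>(2) u1N u2 y(2) linear_on_add[OF linear_d u1N(1) u2(1)]
      by (simp add: inner_diff_left)
    show "\<forall>q\<in>harmonic V d k. (u1 + u2) \<bullet> q = 0"
      using u1(1) u2N harmonicD by (auto simp: inner_add_left)
  qed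
qed

end

section \<open>Duality in coordinates and expansion of squared norms\<close>

lemma dot_mat_vec_transpose:
  "dot b \<xi> (mat_vec b m G c) = dot m (mat_vec m b (mat_transpose G) \<xi>) c"
proof -
  have "dot b \<xi> (mat_vec b m G c) = (\<Sum>i<b. \<Sum>j<m. \<xi> i * (G i j * c j))"
    by (simp add: dot_def mat_vec_def sum_distrib_left)
  also have "\<dots> = (\<Sum>j<m. \<Sum>i<b. \<xi> i * (G i j * c j))" by (rule sum.swap)
  also have "\<dots> = dot m (mat_vec m b (mat_transpose G) \<xi>) c"
    by (simp add: dot_def mat_vec_def mat_transpose_def sum_distrib_left mult_ac)
  finally show ?thesis .
qed

text \<open>The coefficients of \<open>\<xi>\<close> are the values of \<open>\<phi>\<close> on the
  preimages \<open>e j\<close> of the coordinate vectors. This later produces the multiplier of the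
  constraint on \<open>Per h\<close>.\<close>

lemma linear_iso_Euclidean_dual:
  assumes S: "subspace S" and T: "linear_iso_Euclidean n S T" and \<phi>: "linear_on S \<phi>"
  obtains \<xi> where "\<xi> \<in> topspace (Euclidean_space n)" "\<And>x. x \<in> S \<Longrightarrow> \<phi> x = dot n \<xi> (T x)"
proof -
  have lin: "\<And>i. linear_on S (\<lambda>x. T x i)" and bij: "bij_betw T S (topspace (Euclidean_space n))"
    using T by (auto simp: linear_iso_Euclidean_def)
  define e where "e j = inv_into S T (\<lambda>i. if i = j then 1 else 0)" for j
  have e: "e j \<in> S" "T (e j) = (\<lambda>i. if i = j then 1 else 0)" if "j < n" for j
  proof -
    have "(\<lambda>i. if i = j then 1 else 0) \<in> T ` S"
      using bij that by (auto simp: bij_betw_def topspace_Euclidean_space)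
    then show "e j \<in> S" "T (e j) = (\<lambda>i. if i = j then 1 else 0)"
      unfolding e_def by (rule inv_into_into, rule f_inv_into_f)
  qed
  have sum_in: "(\<Sum>j<N. c j *\<^sub>R e j) \<in> S" if "N \<le> n" for c N
    using that e by (intro subspace_sum[OF S] subspace_scale[OF S]) auto
  \<comment> \<open>Stated for real functionals so that it serves for each coordinate of
    \<open>T\<close> as well as for \<open>\<phi>\<close>.\<close>
  have lin_sum: "\<psi> (\<Sum>j<N. c j *\<^sub>R e j) = (\<Sum>j<N. c j * \<psi> (e j))"
    if \<psi>: "linear_on S \<psi>" and "N \<le> n" for \<psi> :: "'a \<Rightarrow> real" and c N
    using \<open>N \<le> n\<close>
  proof (induction N)
    case 0
    then show ?case using linear_on_0[OF \<psi> S] by simp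
  next
    case (Suc N)
    then have "e N \<in> S" using e by simp
    then show ?case
      using Suc linear_on_add[OF \<psi> sum_in[of N c] subspace_scale[OF S]] linear_on_scaleR[OF \<psi>]
      by simp
  qed
  show thesis
  proof (rule that)
    show "(\<lambda>j. if j < n then \<phi> (e j) else 0) \<in> topspace (Euclidean_space n)"
      by (simp add: topspace_Euclidean_space)
    fix x assume x: "x \<in> S"
    let ?x = "\<Sum>j<n. T x j *\<^sub>R e j"
    have "T ?x i = T x i" for i
    proof -
      have "T ?x i = (\<Sum>j<n. T x j * T (e j) i)"
        by (rule lin_sum[OF lin]) simp
      also have "\<dots> = (\<Sum>j<n. if i = j then T x j else 0)"
        using e(2) by (intro sum.cong) auto
      also have "\<dots> = T x i"
        using bij_betwE[OF bij] x by (auto simp: topspace_Euclidean_space)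
      finally show ?thesis .
    qed
    then have "?x = x"
      using inj_onD[OF bij_betw_imp_inj_on[OF bij], of ?x x] sum_in[of n "T x"] x by (simp add: ext)
    then have "\<phi> x = (\<Sum>j<n. T x j * \<phi> (e j))" using lin_sum[OF \<phi>, of n "T x"] by simp
    then show "\<phi> x = dot n (\<lambda>j. if j < n then \<phi> (e j) else 0) (T x)"
      by (simp add: dot_def mult.commute)
  qed
qed

lemma bounded_linear_on_inner:
  assumes "bounded_linear_on S T"
  shows "bounded_linear_on S (\<lambda>x. w * (y \<bullet> T x))"
proof -
  obtain K where K: "\<And>x. x \<in> S \<Longrightarrow> norm (T x) \<le> K * norm x" and lin: "linear_on S T"
    using assms by (auto simp: bounded_linear_on_def)
  have "\<bar>w * (y \<bullet> T x)\<bar> \<le> (\<bar>w\<bar> * norm y * K) * norm x" if "x \<in> S" for x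
  proof -
    have "\<bar>w * (y \<bullet> T x)\<bar> \<le> \<bar>w\<bar> * (norm y * norm (T x))"
      by (simp add: abs_mult mult_left_mono Cauchy_Schwarz_ineq2)
    also have "\<dots> \<le> \<bar>w\<bar> * (norm y * (K * norm x))"
      by (intro mult_left_mono K that) auto
    finally show ?thesis by (simp add: mult.assoc)
  qed
  moreover have "linear_on S (\<lambda>x. w * (y \<bullet> T x))"
    using lin by (simp add: linear_on_def inner_add_right distrib_left)
  ultimately show ?thesis
    unfolding bounded_linear_on_def real_norm_def by blast
qed

lemma power2_norm_affine:
  fixes x y w :: "'a::real_inner"
  shows "(norm (x + t *\<^sub>R y - w))\<^sup>2 = (norm (x - w))\<^sup>2 + t * (2 * ((x - w) \<bullet> y)) + t\<^sup>2 * (norm y)\<^sup>2"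
  unfolding power2_norm_eq_inner
  by (simp add: algebra_simps inner_commute[of y x] inner_commute[of y w] inner_commute[of w x]
      power2_eq_square)

lemma power2_L2_set_affine:
  "(L2_set (\<lambda>i. x i + t * y i - w i) {..<n})\<^sup>2 =
     (L2_set (\<lambda>i. x i - w i) {..<n})\<^sup>2 + t * (2 * dot n (\<lambda>i. x i - w i) y) + t\<^sup>2 * (L2_set y {..<n})\<^sup>2"
proof -
  have sq: "(L2_set f {..<n})\<^sup>2 = (\<Sum>i<n. (f i)\<^sup>2)" for f
    by (simp add: L2_set_def sum_nonneg)
  have "(x i + t * y i - w i)\<^sup>2 = (x i - w i)\<^sup>2 + t * (2 * ((x i - w i) * y i)) + t\<^sup>2 * (y i)\<^sup>2" for i
    by (simp add: power2_eq_square algebra_simps)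
  then show ?thesis
    unfolding sq dot_def by (simp add: sum.distrib sum_distrib_left)
qed

section \<open>The optimality system\<close>

locale hodge_control = closed_hilbert_complex W V d
  for W V :: "int \<Rightarrow> 'w::{real_inner, complete_space} set" and d +
  fixes k :: int and b m :: nat
    and B :: "'z::{real_inner, complete_space} \<Rightarrow> 'w"
    and Obs :: "'w \<Rightarrow> 'y::real_inner"
    and R :: "'w \<Rightarrow> 's::real_inner"
    and Per :: "'w \<Rightarrow> nat \<Rightarrow> real"
    and Z_ad :: "'z set" and A_ad :: "(nat \<Rightarrow> real) set"
    and f :: 'w and y_d :: 'y and r_d :: 's
    and pi_d c\<^sub>0 :: "nat \<Rightarrow> real" and G :: "nat \<Rightarrow> nat \<Rightarrow> real"
    and w_y w_sigma w_Pi \<alpha> \<alpha>_top :: real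
  assumes bounded_linear_B: "bounded_linear B"
    and bounded_linear_Obs: "bounded_linear_on (W k) Obs"
    and bounded_linear_R: "bounded_linear_on (W (k - 1)) R"
    and iso_Per: "linear_iso_Euclidean b (harmonic V d k) Per"
    and convex_Z_ad: "convex Z_ad" and convex_A_ad: "convex_fun A_ad"
    and weights_nonneg: "w_y \<ge> 0" "w_sigma \<ge> 0" "w_Pi \<ge> 0" "\<alpha> \<ge> 0" "\<alpha>_top \<ge> 0"
begin

abbreviation J where
  "J \<equiv> cost Obs R b Per m y_d r_d pi_d w_y w_sigma w_Pi \<alpha> \<alpha>_top"

abbreviation feas where
  "feas \<equiv> feasible V d k B b Per m G c\<^sub>0 f Z_ad A_ad"

text \<open>The homogeneous form of the state constraints: differences of feasible points satisfy
  it, as \<open>f\<close> and \<open>c\<^sub>0\<close> cancel. The control variations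
  \<open>\<zeta>\<close> and \<open>c\<close> are unrestricted.\<close>

definition direction where
  "direction s w q e \<zeta> c \<longleftrightarrow>
     s \<in> V (k - 1) \<and> w \<in> V k \<and> q \<in> harmonic V d k \<and> e \<in> harmonic V d k \<and>
     (\<forall>\<tau>\<in>V (k - 1). s \<bullet> \<tau> - w \<bullet> d (k - 1) \<tau> = 0) \<and>
     (\<forall>v\<in>V k. d (k - 1) s \<bullet> v + d k w \<bullet> d k v + q \<bullet> v = B \<zeta> \<bullet> v) \<and>
     (\<forall>q'\<in>harmonic V d k. w \<bullet> q' = 0) \<and>
     Per e = mat_vec b m G c"

text \<open>The directional derivative of \<open>J\<close> along
  \<open>(s, w, e, \<zeta>, c)\<close>. The variation of \<open>p\<close> is absent because the cost
  does not depend on \<open>p\<close>.\<close>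

definition slope where
  "slope \<sigma> u h z a s w e \<zeta> c =
     w_y * ((Obs (u + h) - y_d) \<bullet> Obs (w + e)) + w_sigma * ((R \<sigma> - r_d) \<bullet> R s)
     + w_Pi * dot b (\<lambda>i. Per h i - pi_d i) (Per e) + \<alpha> * (z \<bullet> \<zeta>) + \<alpha>_top * dot m a c"

text \<open>The adjoint equations without the two variational inequalities. Neither \<open>z\<close>
  nor \<open>a\<close> occurs, so they can be solved before any optimality is known.\<close>

definition multipliers where
  "multipliers \<sigma> u h lam \<mu> \<nu> \<xi> \<longleftrightarrow>
     lam \<in> V (k - 1) \<and> \<mu> \<in> V k \<and> \<nu> \<in> harmonic V d k \<and> \<xi> \<in> topspace (Euclidean_space b) \<and>
     (\<forall>\<tau>\<in>V (k - 1). w_sigma * ((R \<sigma> - r_d) \<bullet> R \<tau>) - lam \<bullet> \<tau> - \<mu> \<bullet> d (k - 1) \<tau> = 0) \<and>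
     (\<forall>v\<in>V k. w_y * ((Obs (u + h) - y_d) \<bullet> Obs v) + v \<bullet> d (k - 1) lam
       - d k \<mu> \<bullet> d k v - v \<bullet> \<nu> = 0) \<and>
     (\<forall>q\<in>harmonic V d k. \<mu> \<bullet> q = 0) \<and>
     (\<forall>\<eta>\<in>harmonic V d k. w_y * ((Obs (u + h) - y_d) \<bullet> Obs \<eta>)
       + w_Pi * dot b (\<lambda>i. Per h i - pi_d i) (Per \<eta>) + dot b \<xi> (Per \<eta>) = 0)"

section \<open>Feasible directions\<close>

lemma linear_Obs: "linear_on (W k) Obs" and linear_R: "linear_on (W (k - 1)) R"
  using bounded_linear_Obs bounded_linear_R by (auto simp: bounded_linear_on_def)

lemma V_W: "x \<in> V j \<Longrightarrow> x \<in> W j"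
  using V_subset_W by blast

lemma harmonic_W: "q \<in> harmonic V d k \<Longrightarrow> q \<in> W k"
  using V_W harmonicD(1) by blast

lemma linear_Per: "linear_on (harmonic V d k) (\<lambda>x. Per x i)"
  using iso_Per by (simp add: linear_iso_Euclidean_def)

lemma Per_affine:
  assumes "h \<in> harmonic V d k" "e \<in> harmonic V d k"
  shows "Per (h + t *\<^sub>R e) i = Per h i + t * Per e i"
  using linear_on_add[OF linear_Per assms(1) subspace_scale[OF subspace_harmonic assms(2)]]
    linear_on_scaleR[OF linear_Per assms(2)] by simp

lemma d_affine:
  assumes "x \<in> V j" "y \<in> V j"
  shows "d j (x + t *\<^sub>R y) = d j x + t *\<^sub>R d j y"
  using linear_on_add[OF linear_d assms(1) subspace_scale[OF subspace_V assms(2)]]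
    linear_on_scaleR[OF linear_d assms(2)] by simp

lemma direction_exists: "\<exists>s w q e. direction s w q e \<zeta> c"
proof -
  \<comment> \<open>The mixed problem with data \<open>F = 0\<close> and
    \<open>g = B \<zeta>\<close>; the harmonic variation \<open>e\<close> comes separately, from
    surjectivity of \<open>Per\<close>.\<close>
  obtain s w q where swq: "s \<in> V (k - 1)" "w \<in> V k" "q \<in> harmonic V d k"
    "\<forall>\<tau>\<in>V (k - 1). s \<bullet> \<tau> - w \<bullet> d (k - 1) \<tau> = 0 \<bullet> \<tau>"
    "\<forall>v\<in>V k. d (k - 1) s \<bullet> v + d k w \<bullet> d k v + q \<bullet> v = B \<zeta> \<bullet> v"
    "\<forall>q'\<in>harmonic V d k. w \<bullet> q' = 0"
    by (rule mixed_hodge_laplace_solvable)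
  have "mat_vec b m G c \<in> Per ` harmonic V d k"
    using iso_Per
    by (auto simp: linear_iso_Euclidean_def bij_betw_def topspace_Euclidean_space mat_vec_def)
  then obtain e where e: "e \<in> harmonic V d k" "Per e = mat_vec b m G c" by force
  have "direction s w q e \<zeta> c"
    unfolding direction_def using swq e by simp
  then show ?thesis by blast
qed

lemma direction_feasible_diff:
  assumes "feas (\<sigma>, u, p, h, z, a)" "feas (\<sigma>', u', p', h', z', a')"
  shows "direction (\<sigma>' - \<sigma>) (u' - u) (p' - p) (h' - h) (z' - z) (\<lambda>j. a' j - a j)"
proof -
  interpret B: bounded_linear B by (rule bounded_linear_B)
  have mem: "\<sigma> \<in> V (k - 1)" "\<sigma>' \<in> V (k - 1)" "u \<in> V k" "u' \<in> V k"
      "h \<in> harmonic V d k" "h' \<in> harmonic V d k" "p \<in> harmonic V d k" "p' \<in> harmonic V d k"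
    and eq: "\<And>\<tau>. \<tau> \<in> V (k - 1) \<Longrightarrow> \<sigma> \<bullet> \<tau> = u \<bullet> d (k - 1) \<tau>"
      "\<And>\<tau>. \<tau> \<in> V (k - 1) \<Longrightarrow> \<sigma>' \<bullet> \<tau> = u' \<bullet> d (k - 1) \<tau>"
      "\<And>v. v \<in> V k \<Longrightarrow> d (k - 1) \<sigma> \<bullet> v + d k u \<bullet> d k v + p \<bullet> v = (f + B z) \<bullet> v"
      "\<And>v. v \<in> V k \<Longrightarrow> d (k - 1) \<sigma>' \<bullet> v + d k u' \<bullet> d k v + p' \<bullet> v = (f + B z') \<bullet> v"
      "\<And>q. q \<in> harmonic V d k \<Longrightarrow> u \<bullet> q = 0" "\<And>q. q \<in> harmonic V d k \<Longrightarrow> u' \<bullet> q = 0"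
      "Per h = (\<lambda>i. mat_vec b m G a i + c\<^sub>0 i)" "Per h' = (\<lambda>i. mat_vec b m G a' i + c\<^sub>0 i)"
    using assms by (auto simp: feasible_def)
  have "Per (h' - h) = mat_vec b m G (\<lambda>j. a' j - a j)"
  proof
    fix i
    have "Per (h' - h) i = Per h' i - Per h i"
      by (rule linear_on_diff[OF linear_Per subspace_harmonic mem(6,5)])
    then show "Per (h' - h) i = mat_vec b m G (\<lambda>j. a' j - a j) i"
      by (simp add: eq mat_vec_def sum_subtractf right_diff_distrib)
  qed
  moreover have "d (k - 1) (\<sigma>' - \<sigma>) = d (k - 1) \<sigma>' - d (k - 1) \<sigma>" "d k (u' - u) = d k u' - d k u"
    by (intro linear_on_diff[OF linear_d subspace_V] mem)+
  moreover have "(d (k - 1) \<sigma>' - d (k - 1) \<sigma>) \<bullet> v + (d k u' - d k u) \<bullet> d k v + (p' - p) \<bullet> v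
      = B (z' - z) \<bullet> v" if "v \<in> V k" for v
    using eq(3,4)[OF that] by (simp add: B.diff inner_diff_left inner_add_left)
  ultimately show ?thesis
    unfolding direction_def using mem eq(1,2,5,6)
    by (simp add: subspace_diff subspace_V subspace_harmonic inner_diff_left)
qed

lemma feasible_direction:
  assumes x: "feas (\<sigma>, u, p, h, z, a)" and dir: "direction s w q e \<zeta> c"
    and "z + t *\<^sub>R \<zeta> \<in> Z_ad" "(\<lambda>j. a j + t * c j) \<in> A_ad"
  shows "feas (\<sigma> + t *\<^sub>R s, u + t *\<^sub>R w, p + t *\<^sub>R q, h + t *\<^sub>R e, z + t *\<^sub>R \<zeta>, \<lambda>j. a j + t * c j)"
proof -
  interpret B: bounded_linear B by (rule bounded_linear_B)
  have mem: "\<sigma> \<in> V (k - 1)" "s \<in> V (k - 1)" "u \<in> V k" "w \<in> V k"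
      "h \<in> harmonic V d k" "e \<in> harmonic V d k" "p \<in> harmonic V d k" "q \<in> harmonic V d k"
    and eq: "\<And>\<tau>. \<tau> \<in> V (k - 1) \<Longrightarrow> \<sigma> \<bullet> \<tau> = u \<bullet> d (k - 1) \<tau>"
      "\<And>\<tau>. \<tau> \<in> V (k - 1) \<Longrightarrow> s \<bullet> \<tau> = w \<bullet> d (k - 1) \<tau>"
      "\<And>v. v \<in> V k \<Longrightarrow> d (k - 1) \<sigma> \<bullet> v + d k u \<bullet> d k v + p \<bullet> v = (f + B z) \<bullet> v"
      "\<And>v. v \<in> V k \<Longrightarrow> B \<zeta> \<bullet> v = d (k - 1) s \<bullet> v + d k w \<bullet> d k v + q \<bullet> v"
      "\<And>q. q \<in> harmonic V d k \<Longrightarrow> u \<bullet> q = 0" "\<And>q. q \<in> harmonic V d k \<Longrightarrow> w \<bullet> q = 0"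
      "Per h = (\<lambda>i. mat_vec b m G a i + c\<^sub>0 i)" "Per e = mat_vec b m G c"
    using x dir by (auto simp: feasible_def direction_def)
  have "Per (h + t *\<^sub>R e) = (\<lambda>i. mat_vec b m G (\<lambda>j. a j + t * c j) i + c\<^sub>0 i)"
  proof
    fix i
    show "Per (h + t *\<^sub>R e) i = mat_vec b m G (\<lambda>j. a j + t * c j) i + c\<^sub>0 i"
      unfolding Per_affine[OF mem(5,6)]
      by (simp add: eq mat_vec_def sum.distrib sum_distrib_left distrib_left mult_ac)
  qed
  moreover have "(d (k - 1) \<sigma> + t *\<^sub>R d (k - 1) s) \<bullet> v + (d k u + t *\<^sub>R d k w) \<bullet> d k v
      + (p + t *\<^sub>R q) \<bullet> v = (f + B (z + t *\<^sub>R \<zeta>)) \<bullet> v" if "v \<in> V k" for v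
    using eq(3,4)[OF that] by (simp add: B.add B.scaleR inner_add_left algebra_simps)
  ultimately show ?thesis
    unfolding feasible_def using mem eq(1,2,5,6) assms(3,4)
    by (simp add: subspace_add subspace_scale subspace_V subspace_harmonic inner_add_left d_affine)
qed

text \<open>The cost is exactly quadratic along a line, and \<open>Q\<close> does not depend on
  \<open>t\<close>. Small \<open>t\<close> gives the necessary condition; \<open>t = 1\<close>
  together with \<open>Q \<ge> 0\<close> gives sufficiency.\<close>

lemma cost_expansion:
  assumes x: "\<sigma> \<in> V (k - 1)" "u \<in> V k" "h \<in> harmonic V d k" and dir: "direction s w q e \<zeta> c"
  obtains Q where "Q \<ge> 0"
    "\<And>t. J (\<sigma> + t *\<^sub>R s) (u + t *\<^sub>R w) (h + t *\<^sub>R e) (z + t *\<^sub>R \<zeta>) (\<lambda>j. a j + t * c j)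
       = J \<sigma> u h z a + t * slope \<sigma> u h z a s w e \<zeta> c + t\<^sup>2 * Q"
proof -
  have mem: "s \<in> V (k - 1)" "w \<in> V k" "e \<in> harmonic V d k"
    using dir by (auto simp: direction_def)
  have R: "R (\<sigma> + t *\<^sub>R s) = R \<sigma> + t *\<^sub>R R s" for t
    using linear_on_add[OF linear_R] linear_on_scaleR[OF linear_R] x mem V_W
    by (simp add: subspace_scale subspace_W)
  have Obs: "Obs (u + t *\<^sub>R w + (h + t *\<^sub>R e)) = Obs (u + h) + t *\<^sub>R Obs (w + e)" for t
  proof -
    have "u + h \<in> W k" "w + e \<in> W k"
      using x mem V_W harmonic_W by (simp_all add: subspace_add subspace_W)
    then have "Obs (u + h + t *\<^sub>R (w + e)) = Obs (u + h) + t *\<^sub>R Obs (w + e)"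
      using linear_on_add[OF linear_Obs] linear_on_scaleR[OF linear_Obs]
      by (simp add: subspace_scale subspace_W)
    then show ?thesis by (simp add: algebra_simps)
  qed
  have z: "(norm (z + t *\<^sub>R \<zeta>))\<^sup>2 = (norm z)\<^sup>2 + t * (2 * (z \<bullet> \<zeta>)) + t\<^sup>2 * (norm \<zeta>)\<^sup>2" for t
    using power2_norm_affine[of z t \<zeta> 0] by simp
  have a: "(L2_set (\<lambda>j. a j + t * c j) {..<m})\<^sup>2
      = (L2_set a {..<m})\<^sup>2 + t * (2 * dot m a c) + t\<^sup>2 * (L2_set c {..<m})\<^sup>2" for t
    using power2_L2_set_affine[of a t c "\<lambda>_. 0" m] by simp
  show thesis
  proof (rule that)
    show "0 \<le> w_y / 2 * (norm (Obs (w + e)))\<^sup>2 + w_sigma / 2 * (norm (R s))\<^sup>2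
        + w_Pi / 2 * (L2_set (Per e) {..<b})\<^sup>2 + \<alpha> / 2 * (norm \<zeta>)\<^sup>2 + \<alpha>_top / 2 * (L2_set c {..<m})\<^sup>2"
      using weights_nonneg by (intro add_nonneg_nonneg mult_nonneg_nonneg) auto
    fix t
    show "J (\<sigma> + t *\<^sub>R s) (u + t *\<^sub>R w) (h + t *\<^sub>R e) (z + t *\<^sub>R \<zeta>) (\<lambda>j. a j + t * c j)
       = J \<sigma> u h z a + t * slope \<sigma> u h z a s w e \<zeta> c
         + t\<^sup>2 * (w_y / 2 * (norm (Obs (w + e)))\<^sup>2 + w_sigma / 2 * (norm (R s))\<^sup>2
        + w_Pi / 2 * (L2_set (Per e) {..<b})\<^sup>2 + \<alpha> / 2 * (norm \<zeta>)\<^sup>2 + \<alpha>_top / 2 * (L2_set c {..<m})\<^sup>2)"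
      unfolding cost_def slope_def R Obs Per_affine[OF x(3) mem(3)] power2_norm_affine
        power2_L2_set_affine z a
      by (simp add: ring_distribs mult_ac)
  qed
qed

text \<open>The two systems are tested with each other: the adjoint equations with \<open>s\<close>,
  \<open>w\<close>, \<open>e\<close>, and the direction equations with \<open>lam\<close>,
  \<open>\<mu>\<close>, \<open>\<nu>\<close>. All state variations cancel and only
  \<open>\<zeta>\<close> and \<open>c\<close> survive.\<close>

lemma slope_multipliers:
  assumes mult: "multipliers \<sigma> u h lam \<mu> \<nu> \<xi>" and dir: "direction s w q e \<zeta> c"
  shows "slope \<sigma> u h z a s w e \<zeta> c = (\<alpha> *\<^sub>R z + adjoint B \<mu>) \<bullet> \<zeta>
    + dot m (\<lambda>j. \<alpha>_top * a j - mat_vec m b (mat_transpose G) \<xi> j) c"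
proof -
  let ?y = "Obs (u + h) - y_d" and ?r = "R \<sigma> - r_d"
  have mem: "s \<in> V (k - 1)" "w \<in> V k" "q \<in> harmonic V d k" "e \<in> harmonic V d k"
      "lam \<in> V (k - 1)" "\<mu> \<in> V k" "\<nu> \<in> harmonic V d k" and Per: "Per e = mat_vec b m G c"
    using mult dir by (auto simp: multipliers_def direction_def)
  have "w_sigma * (?r \<bullet> R s) = lam \<bullet> s + \<mu> \<bullet> d (k - 1) s"
    and "w_y * (?y \<bullet> Obs w) = d k \<mu> \<bullet> d k w + w \<bullet> \<nu> - w \<bullet> d (k - 1) lam"
    and e: "w_y * (?y \<bullet> Obs e) + w_Pi * dot b (\<lambda>i. Per h i - pi_d i) (Per e) = - dot b \<xi> (Per e)"
    and "\<mu> \<bullet> q = 0"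
    using mult mem(1-4) by (auto simp: multipliers_def algebra_simps)
  \<comment> \<open>These are the direction equations tested with \<open>lam\<close>,
    \<open>\<nu>\<close> and \<open>\<mu>\<close>. They cancel the \<open>lam\<close> and
    \<open>\<nu>\<close> terms above, and \<open>\<mu> \<bullet> q = 0\<close> removes
    \<open>q\<close> from the last one.\<close>
  moreover have "s \<bullet> lam = w \<bullet> d (k - 1) lam" "w \<bullet> \<nu> = 0"
      "d (k - 1) s \<bullet> \<mu> + d k w \<bullet> d k \<mu> + q \<bullet> \<mu> = B \<zeta> \<bullet> \<mu>"
    using dir mem(5-7) by (auto simp: direction_def)
  moreover have "B \<zeta> \<bullet> \<mu> = adjoint B \<mu> \<bullet> \<zeta>"
    using adjoint_complete[OF bounded_linear_B] by (simp add: inner_commute)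
  ultimately have "w_sigma * (?r \<bullet> R s) + w_y * (?y \<bullet> Obs w) = adjoint B \<mu> \<bullet> \<zeta>"
    by (simp add: inner_commute)
  moreover have "Obs (w + e) = Obs w + Obs e"
    using linear_on_add[OF linear_Obs V_W[OF mem(2)] harmonic_W[OF mem(4)]] .
  \<comment> \<open>Since \<open>Per e\<close> is \<open>G\<close> applied to \<open>c\<close>,
    transposition turns the harmonic contribution \<open>- dot b \<xi> (Per e)\<close> into a term
    in \<open>c\<close>.\<close>
  moreover have "dot m (\<lambda>j. \<alpha>_top * a j - mat_vec m b (mat_transpose G) \<xi> j) c
      = \<alpha>_top * dot m a c - dot b \<xi> (Per e)"
    unfolding Per dot_mat_vec_transpose
    by (simp add: dot_def sum_subtractf sum_distrib_left algebra_simps)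
  ultimately show ?thesis
    using e unfolding slope_def by (simp add: inner_add_right inner_add_left algebra_simps)
qed

lemma multipliers_exist:
  assumes "h \<in> harmonic V d k"
  obtains lam \<mu> \<nu> \<xi> where "multipliers \<sigma> u h lam \<mu> \<nu> \<xi>"
proof -
  let ?y = "Obs (u + h) - y_d" and ?r = "R \<sigma> - r_d"
  obtain F where F: "\<And>\<tau>. \<tau> \<in> W (k - 1) \<Longrightarrow> w_sigma * (?r \<bullet> R \<tau>) = F \<bullet> \<tau>"
    using riesz_representation[OF subspace_W closed_W bounded_linear_on_inner[OF bounded_linear_R]]
    by metis
  obtain g where g: "\<And>v. v \<in> W k \<Longrightarrow> w_y * (?y \<bullet> Obs v) = g \<bullet> v"
    using riesz_representation[OF subspace_W closed_W bounded_linear_on_inner[OF bounded_linear_Obs]]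
    by metis
  \<comment> \<open>The adjoint system is again a mixed problem, with data \<open>- F\<close> and
    \<open>g\<close>. The sign of \<open>F\<close> is chosen so that \<open>lam = - s\<close> solves
    the system as stated.\<close>
  obtain s \<mu> \<nu> where s: "s \<in> V (k - 1)" "\<mu> \<in> V k" "\<nu> \<in> harmonic V d k"
    "\<forall>\<tau>\<in>V (k - 1). s \<bullet> \<tau> - \<mu> \<bullet> d (k - 1) \<tau> = (- F) \<bullet> \<tau>"
    "\<forall>v\<in>V k. d (k - 1) s \<bullet> v + d k \<mu> \<bullet> d k v + \<nu> \<bullet> v = g \<bullet> v"
    "\<forall>q\<in>harmonic V d k. \<mu> \<bullet> q = 0"
    by (rule mixed_hodge_laplace_solvable)
  \<comment> \<open>Minus the derivative of the cost in \<open>h\<close>; its coordinate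
    representative is \<open>\<xi>\<close>.\<close>
  let ?\<phi> = "\<lambda>\<eta>. - (w_y * (?y \<bullet> Obs \<eta>) + w_Pi * dot b (\<lambda>i. Per h i - pi_d i) (Per \<eta>))"
  have "linear_on (harmonic V d k) ?\<phi>"
    unfolding linear_on_def
  proof (intro conjI ballI allI)
    fix x y assume xy: "x \<in> harmonic V d k" "y \<in> harmonic V d k"
    have "dot b c (Per (x + y)) = dot b c (Per x) + dot b c (Per y)" for c
      using linear_on_add[OF linear_Per xy] by (simp add: dot_def sum.distrib distrib_left)
    then show "?\<phi> (x + y) = ?\<phi> x + ?\<phi> y"
      using linear_on_add[OF linear_Obs harmonic_W[OF xy(1)] harmonic_W[OF xy(2)]]
      by (simp add: inner_add_right algebra_simps)
  next
    fix c x assume x: "x \<in> harmonic V d k"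
    have "dot b c' (Per (c *\<^sub>R x)) = c * dot b c' (Per x)" for c'
      using linear_on_scaleR[OF linear_Per x] by (simp add: dot_def sum_distrib_left mult_ac)
    then show "?\<phi> (c *\<^sub>R x) = c *\<^sub>R ?\<phi> x"
      using linear_on_scaleR[OF linear_Obs harmonic_W[OF x]] by (simp add: algebra_simps)
  qed
  then obtain \<xi> where \<xi>: "\<xi> \<in> topspace (Euclidean_space b)"
      "\<And>\<eta>. \<eta> \<in> harmonic V d k \<Longrightarrow> ?\<phi> \<eta> = dot b \<xi> (Per \<eta>)"
    by (rule linear_iso_Euclidean_dual[OF subspace_harmonic iso_Per]) blast
  have ds: "d (k - 1) (- s) = - d (k - 1) s"
    using linear_on_scaleR[OF linear_d s(1), of "-1"] by simp
  have "multipliers \<sigma> u h (- s) \<mu> \<nu> \<xi>"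
    unfolding multipliers_def
  proof (intro conjI ballI)
    fix \<tau> assume \<tau>: "\<tau> \<in> V (k - 1)"
    show "w_sigma * (?r \<bullet> R \<tau>) - (- s) \<bullet> \<tau> - \<mu> \<bullet> d (k - 1) \<tau> = 0"
      using bspec[OF s(4) \<tau>] F[OF V_W[OF \<tau>]] by simp
  next
    fix v assume v: "v \<in> V k"
    show "w_y * (?y \<bullet> Obs v) + v \<bullet> d (k - 1) (- s) - d k \<mu> \<bullet> d k v - v \<bullet> \<nu> = 0"
      unfolding ds using bspec[OF s(5) v] g[OF V_W[OF v]] by (simp add: inner_commute[of v])
  next
    fix \<eta> assume "\<eta> \<in> harmonic V d k"
    then show "w_y * (?y \<bullet> Obs \<eta>) + w_Pi * dot b (\<lambda>i. Per h i - pi_d i) (Per \<eta>)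
        + dot b \<xi> (Per \<eta>) = 0"
      using \<xi>(2)[of \<eta>] by linarith
  qed (use s \<xi>(1) subspace_neg[OF subspace_V] in auto)
  then show thesis by (rule that)
qed

text \<open>By convexity the controls on the segment towards \<open>(z', a')\<close> stay
  admissible, and moving the state along the direction keeps the point feasible. Optimality bounds
  the increment below by 0, and \<open>nonneg_slope\<close> discards the quadratic term.\<close>

lemma optimal_slope_nonneg:
  assumes x: "feas (\<sigma>, u, p, h, z, a)"
    and opt: "\<And>\<sigma>' u' p' h' z' a'. feas (\<sigma>', u', p', h', z', a') \<Longrightarrow> J \<sigma> u h z a \<le> J \<sigma>' u' h' z' a'"
    and z': "z' \<in> Z_ad" and a': "a' \<in> A_ad"
    and dir: "direction s w q e (z' - z) (\<lambda>j. a' j - a j)"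
  shows "0 \<le> slope \<sigma> u h z a s w e (z' - z) (\<lambda>j. a' j - a j)"
proof -
  have mem: "\<sigma> \<in> V (k - 1)" "u \<in> V k" "h \<in> harmonic V d k" "z \<in> Z_ad" "a \<in> A_ad"
    using x by (auto simp: feasible_def)
  obtain Q where "Q \<ge> 0"
    and Q: "\<And>t. J (\<sigma> + t *\<^sub>R s) (u + t *\<^sub>R w) (h + t *\<^sub>R e) (z + t *\<^sub>R (z' - z))
        (\<lambda>j. a j + t * (a' j - a j))
      = J \<sigma> u h z a + t * slope \<sigma> u h z a s w e (z' - z) (\<lambda>j. a' j - a j) + t\<^sup>2 * Q"
    by (rule cost_expansion[OF mem(1-3) dir, where z = z and a = a]) blast
  show ?thesis
  proof (rule nonneg_slope)
    fix t :: real assume t: "0 < t" "t \<le> 1"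
    have "(1 - t) *\<^sub>R z + t *\<^sub>R z' \<in> Z_ad"
      using t by (intro convexD[OF convex_Z_ad mem(4) z']) auto
    then have "z + t *\<^sub>R (z' - z) \<in> Z_ad" by (simp add: algebra_simps)
    moreover have "(\<lambda>j. (1 - t) * a j + t * a' j) \<in> A_ad"
      using convex_A_ad mem(5) a' t by (auto simp: convex_fun_def)
    then have "(\<lambda>j. a j + t * (a' j - a j)) \<in> A_ad" by (simp add: algebra_simps)
    ultimately have "feas (\<sigma> + t *\<^sub>R s, u + t *\<^sub>R w, p + t *\<^sub>R q, h + t *\<^sub>R e, z + t *\<^sub>R (z' - z),
        \<lambda>j. a j + t * (a' j - a j))"
      by (rule feasible_direction[OF x dir])
    from opt[OF this] show "0 \<le> t * slope \<sigma> u h z a s w e (z' - z) (\<lambda>j. a' j - a j) + t\<^sup>2 * Q"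
      unfolding Q by linarith
  qed
qed

lemma optimal_if_slope_nonneg:
  assumes x: "feas (\<sigma>, u, p, h, z, a)" and x': "feas (\<sigma>', u', p', h', z', a')"
    and slope: "0 \<le> slope \<sigma> u h z a (\<sigma>' - \<sigma>) (u' - u) (h' - h) (z' - z) (\<lambda>j. a' j - a j)"
  shows "J \<sigma> u h z a \<le> J \<sigma>' u' h' z' a'"
proof -
  have mem: "\<sigma> \<in> V (k - 1)" "u \<in> V k" "h \<in> harmonic V d k"
    using x by (auto simp: feasible_def)
  obtain Q where "Q \<ge> 0"
    and Q: "\<And>t. J (\<sigma> + t *\<^sub>R (\<sigma>' - \<sigma>)) (u + t *\<^sub>R (u' - u)) (h + t *\<^sub>R (h' - h)) (z + t *\<^sub>R (z' - z))
        (\<lambda>j. a j + t * (a' j - a j))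
      = J \<sigma> u h z a
        + t * slope \<sigma> u h z a (\<sigma>' - \<sigma>) (u' - u) (h' - h) (z' - z) (\<lambda>j. a' j - a j) + t\<^sup>2 * Q"
    by (rule cost_expansion[OF mem direction_feasible_diff[OF x x'], where z = z and a = a]) blast
  \<comment> \<open>At \<open>t = 1\<close> the displaced point is the competitor itself, and both
    added terms are nonnegative.\<close>
  then show ?thesis using Q[of 1] slope by simp
qed

lemma optimal_iff_multipliers:
  assumes x: "feas (\<sigma>, u, p, h, z, a)"
  shows "is_arg_min (\<lambda>(\<sigma>, u, p, h, z, a). J \<sigma> u h z a) feas (\<sigma>, u, p, h, z, a) \<longleftrightarrow>
    (\<exists>lam \<mu> \<nu> \<xi>. multipliers \<sigma> u h lam \<mu> \<nu> \<xi> \<and>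
      (\<forall>z'\<in>Z_ad. (\<alpha> *\<^sub>R z + adjoint B \<mu>) \<bullet> (z' - z) \<ge> 0) \<and>
      (\<forall>a'\<in>A_ad.
         dot m (\<lambda>j. \<alpha>_top * a j - mat_vec m b (mat_transpose G) \<xi> j) (\<lambda>j. a' j - a j) \<ge> 0))"
    (is "?opt \<longleftrightarrow> (\<exists>lam \<mu> \<nu> \<xi>. _ \<and> ?vi_z \<mu> \<and> ?vi_a \<xi>)")
proof
  assume opt: ?opt
  have mem: "h \<in> harmonic V d k" "z \<in> Z_ad" "a \<in> A_ad" using x by (auto simp: feasible_def)
  obtain lam \<mu> \<nu> \<xi> where mult: "multipliers \<sigma> u h lam \<mu> \<nu> \<xi>"
    using multipliers_exist[OF mem(1)] by metis
  \<comment> \<open>The slope for arbitrary admissible targets, with the state variation eliminated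
    by the multipliers. At first only the sum of the two control terms is known to be
    nonnegative.\<close>
  have ge: "0 \<le> (\<alpha> *\<^sub>R z + adjoint B \<mu>) \<bullet> (z' - z)
      + dot m (\<lambda>j. \<alpha>_top * a j - mat_vec m b (mat_transpose G) \<xi> j) (\<lambda>j. a' j - a j)"
    if "z' \<in> Z_ad" "a' \<in> A_ad" for z' a'
  proof -
    obtain s w q e where dir: "direction s w q e (z' - z) (\<lambda>j. a' j - a j)"
      using direction_exists by blast
    have "0 \<le> slope \<sigma> u h z a s w e (z' - z) (\<lambda>j. a' j - a j)"
      by (rule optimal_slope_nonneg[OF x _ that dir]) (use opt in \<open>auto simp: is_arg_min_linorder\<close>)
    then show ?thesis unfolding slope_multipliers[OF mult dir] .
  qed
  \<comment> \<open>The targets \<open>z'\<close> and \<open>a'\<close> vary independently: taking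
    \<open>a' = a\<close> or \<open>z' = z\<close> makes the other term vanish and separates the two
    inequalities.\<close>
  have "?vi_z \<mu>" using ge[OF _ mem(3)] by (simp add: dot_def)
  moreover have "?vi_a \<xi>" using ge[OF mem(2)] by simp
  ultimately show "\<exists>lam \<mu> \<nu> \<xi>. multipliers \<sigma> u h lam \<mu> \<nu> \<xi> \<and> ?vi_z \<mu> \<and> ?vi_a \<xi>"
    using mult by blast
next
  assume "\<exists>lam \<mu> \<nu> \<xi>. multipliers \<sigma> u h lam \<mu> \<nu> \<xi> \<and> ?vi_z \<mu> \<and> ?vi_a \<xi>"
  then obtain lam \<mu> \<nu> \<xi> where mult: "multipliers \<sigma> u h lam \<mu> \<nu> \<xi>" and vi: "?vi_z \<mu>" "?vi_a \<xi>"
    by blast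
  have "J \<sigma> u h z a \<le> J \<sigma>' u' h' z' a'" if x': "feas (\<sigma>', u', p', h', z', a')"
    for \<sigma>' u' p' h' z' a'
  proof (rule optimal_if_slope_nonneg[OF x x'])
    have "z' \<in> Z_ad" "a' \<in> A_ad" using x' by (auto simp: feasible_def)
    then show "0 \<le> slope \<sigma> u h z a (\<sigma>' - \<sigma>) (u' - u) (h' - h) (z' - z) (\<lambda>j. a' j - a j)"
      unfolding slope_multipliers[OF mult direction_feasible_diff[OF x x']]
      using vi by (intro add_nonneg_nonneg) auto
  qed
  then show ?opt using x by (auto simp: is_arg_min_linorder)
qed

end

theorem theorem4p2:
  fixes W V :: "int \<Rightarrow> 'w::{real_inner, complete_space} set"
    and d :: "int \<Rightarrow> 'w \<Rightarrow> 'w"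
    and k :: int
    and b m :: nat
    and B :: "'z::{real_inner, complete_space} \<Rightarrow> 'w"
    and Obs :: "'w \<Rightarrow> 'y::{real_inner, complete_space}"
    and R :: "'w \<Rightarrow> 's::{real_inner, complete_space}"
    and Per :: "'w \<Rightarrow> nat \<Rightarrow> real"
    and Z_ad :: "'z set"
    and A_ad :: "(nat \<Rightarrow> real) set"
    and f :: 'w and y_d :: 'y and r_d :: 's
    and pi_d c\<^sub>0 :: "nat \<Rightarrow> real"
    and G :: "nat \<Rightarrow> nat \<Rightarrow> real"
    and w_y w_sigma w_Pi \<alpha> \<alpha>_top :: real
    and \<sigma> u p h :: 'w and z :: 'z and a :: "nat \<Rightarrow> real"
  assumes "closed_hilbert_complex W V d"
    and "\<exists>S. finite S \<and> span S = harmonic V d k"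
    and "dim (harmonic V d k) = b"
    and "bounded_linear B" and "range B \<subseteq> W k"
    and "bounded_linear_on (W k) Obs"
    and "bounded_linear_on (W (k - 1)) R"
    and "linear_iso_Euclidean b (harmonic V d k) Per"
    and "Z_ad \<noteq> {}" and "closed Z_ad" and "convex Z_ad"
    and "A_ad \<noteq> {}" and "closedin (Euclidean_space m) A_ad" and "convex_fun A_ad"
    and "f \<in> W k"
    and "pi_d \<in> topspace (Euclidean_space b)" and "c\<^sub>0 \<in> topspace (Euclidean_space b)"
    and "w_y \<ge> 0" and "w_sigma \<ge> 0" and "w_Pi \<ge> 0" and "\<alpha> > 0" and "\<alpha>_top > 0"
    and "feasible V d k B b Per m G c\<^sub>0 f Z_ad A_ad (\<sigma>, u, p, h, z, a)"
  shows
    "is_arg_min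
       (\<lambda>(\<sigma>, u, p, h, z, a).
          cost Obs R b Per m y_d r_d pi_d w_y w_sigma w_Pi \<alpha> \<alpha>_top \<sigma> u h z a)
       (feasible V d k B b Per m G c\<^sub>0 f Z_ad A_ad)
       (\<sigma>, u, p, h, z, a)
     \<longleftrightarrow>
     (\<exists>lam\<in>V (k - 1). \<exists>\<mu>\<in>V k. \<exists>\<nu>\<in>harmonic V d k. \<exists>\<xi>\<in>topspace (Euclidean_space b).
        (\<forall>\<tau>\<in>V (k - 1).
           w_sigma * ((R \<sigma> - r_d) \<bullet> R \<tau>) - lam \<bullet> \<tau> - \<mu> \<bullet> d (k - 1) \<tau> = 0) \<and>
        (\<forall>v\<in>V k.
           w_y * ((Obs (u + h) - y_d) \<bullet> Obs v) + v \<bullet> d (k - 1) lam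
             - d k \<mu> \<bullet> d k v - v \<bullet> \<nu> = 0) \<and>
        (\<forall>q\<in>harmonic V d k. \<mu> \<bullet> q = 0) \<and>
        (\<forall>\<eta>\<in>harmonic V d k.
           w_y * ((Obs (u + h) - y_d) \<bullet> Obs \<eta>)
             + w_Pi * dot b (\<lambda>i. Per h i - pi_d i) (Per \<eta>) + dot b \<xi> (Per \<eta>) = 0) \<and>
        (\<forall>z'\<in>Z_ad. (\<alpha> *\<^sub>R z + adjoint B \<mu>) \<bullet> (z' - z) \<ge> 0) \<and>
        (\<forall>a'\<in>A_ad.
           dot m (\<lambda>j. \<alpha>_top * a j - mat_vec m b (mat_transpose G) \<xi> j) (\<lambda>j. a' j - a j) \<ge> 0))"
proof -
  interpret closed_hilbert_complex W V d by fact
  interpret hodge_control W V d k b m B Obs R Per Z_ad A_ad f y_d r_d pi_d c\<^sub>0 G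
      w_y w_sigma w_Pi \<alpha> \<alpha>_top
    by (intro hodge_control.intro hodge_control_axioms.intro assms)
      (use assms(18-22) in simp_all)
  show ?thesis
    unfolding optimal_iff_multipliers[OF assms(23)] multipliers_def
    by (simp only: Bex_def conj_assoc ex_simps)
qed

end
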